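(* For every $t\in\{0,1,2,\dots\}$ the following assertions hold almost surely. (i) The one-step predictive law satisfies $\pi_{t+1}^{-}=\mathcal L_{U_t}\pi_t$. (ii) For every nonempty observable class $O_j$, the class-restricted unnormalized conditional measure $\widetilde\pi_{t+1}^{\,j}:=\widetilde{\mathcal L}_{U_t,j}\pi_t$ has the explicit representation $$\widetilde\pi_{t+1}^{\,j}(C)=\int_{\mathcal X}\int_{\mathsf E}\int_{\mathsf V}\mathbf 1_{C\cap O_j}\bigl(G(x,U_t,e,v)\bigr)\,\nu_\varepsilon(dv)\,\nu_\eta(de)\,\pi_t(dx)\qquad\text{for all } C\in\mathcal B(\mathcal X).$$ (iii) Its total mass is the predictive probability of the next observation: $$\widetilde\pi_{t+1}^{\,j}(\mathcal X)=p_j(\pi_t,U_t)=\mathbb P(Y_{t+1}=j\mid\mathcal H_t).$$ (iv) On the event $\{Y_{t+1}=j,\ p_j(\pi_t,U_t)>0\}$, the filtered conditional law is $$\pi_{t+1}=\Phi_j(\pi_t,U_t)=\frac{\widetilde\pi_{t+1}^{\,j}}{\widetilde\pi_{t+1}^{\,j}(\mathcal X)}.$$ Equivalently, $\pi_{t+1}=\Phi_{Y_{t+1}}(\pi_t,U_t)$ $\mathbb P$-almost surely.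
   Context: Model. $(\Omega,\mathcal F,\mathbb P)$ is a complete probability space; $\mathcal X$ (states), $\mathcal U$ (actions), $\mathsf E$, $\mathsf V$ (noises) are standard Borel spaces; $\mathcal P(\mathcal X)$ is the set of probability measures on $(\mathcal X,\mathcal B(\mathcal X))$. $G:\mathcal X\times\mathcal U\times\mathsf E\times\mathsf V\to\mathcal X$ is Borel measurable and $X_{t+1}=G(X_t,U_t,\eta_{t+1},\varepsilon_{t+1})$ for $t\ge 0$, where $(\eta_t)_{t\ge1}$ is i.i.d. with law $\nu_\eta$ on $\mathsf E$, $(\varepsilon_t)_{t\ge1}$ is i.i.d. with law $\nu_\varepsilon$ on $\mathsf V$, and $X_0$, $(\eta_t)_t$, $(\varepsilon_t)_t$ are mutually independent. The controlled kernel is $Q(C\mid x,u)=\int_{\mathsf E}\int_{\mathsf V}\mathbf 1_C(G(x,u,e,v))\,\nu_\varepsilon(dv)\,\nu_\eta(de)$. Observations. $A_1,\dots,A_m$ is a finite measurable partition of $\mathcal X$; $O_j=\bigcup_{i\in J_j}A_i$ for $j=1,\dots,r$, with $J_1,\dots,J_r\subseteq\{1,\dots,m\}$ nonempty and pairwise disjoint; $O_{r+1}=\mathcal X\setminus\bigcup_{j\le r}O_j$ (index $r+1$ is omitted if this is empty). The observation is $Y_t=j\iff X_t\in O_j$. The information is $\mathcal H_t=\sigma(Y_0,U_0,Y_1,U_1,\dots,U_{t-1},Y_t)$, $\mathcal H_0=\sigma(Y_0)$, and $U_t$ is $\mathcal H_t$-measurable for all $t$. $\pi_t(C)=\mathbb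 P(X_t\in C\mid\mathcal H_t)$ and $\pi_{t+1}^-(C)=\mathbb P(X_{t+1}\in C\mid\mathcal H_t)$ denote regular versions with values in $\mathcal P(\mathcal X)$. Filter operators. For $\mu\in\mathcal P(\mathcal X)$, $u\in\mathcal U$ and $j$ with $O_j\ne\varnothing$: $(\mathcal L_u\mu)(C)=\int_{\mathcal X}Q(C\mid x,u)\,\mu(dx)$; $\widetilde{\mathcal L}_{u,j}\mu(C)=(\mathcal L_u\mu)(C\cap O_j)$; $p_j(\mu,u)=(\mathcal L_u\mu)(O_j)$. For each nonempty $O_j$ fix $\rho_j\in\mathcal P(\mathcal X)$ with $\rho_j(O_j)=1$, and set $\Phi_j(\mu,u)=\widetilde{\mathcal L}_{u,j}\mu/p_j(\mu,u)$ if $p_j(\mu,u)>0$ and $\Phi_j(\mu,u)=\rho_j$ if $p_j(\mu,u)=0$ (branches with $p_j(\mu,u)=0$ are regarded as unreachable from $(\mu,u)$). *)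

theory Defs
  imports "HOL-Probability.Probability"
begin

definition standard_borel :: "'a measure \<Rightarrow> bool" where
  "standard_borel N \<longleftrightarrow>
     (\<exists>T. topspace T = space N \<and> completely_metrizable_space T \<and> second_countable T \<and>
          sets N = sigma_sets (topspace T) {S. openin T S})"


section \<open>Filter operators\<close>

definition controlled_kernel ::
  "('x \<times> 'u \<times> 'e \<times> 'v \<Rightarrow> 'x) \<Rightarrow> 'e measure \<Rightarrow> 'v measure \<Rightarrow> 'x set \<Rightarrow> 'x \<Rightarrow> 'u \<Rightarrow> ennreal" where
  "controlled_kernel G \<nu>\<eta> \<nu>\<epsilon> C x u =
     (\<integral>\<^sup>+ e. (\<integral>\<^sup>+ v. indicator C (G (x, u, e, v)) \<partial>\<nu>\<epsilon>) \<partial>\<nu>\<eta>)"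

text \<open>
  Below, \<^const>\<open>measure_of\<close> turns a set function on the measurable sets into a measure. That the
  set functions in question are countably additive is confirmed by the lemmas
  \<open>emeasure_predict\<close> and \<open>emeasure_restricted_predict\<close>.
\<close>

definition predict ::
  "'x measure \<Rightarrow> ('x \<times> 'u \<times> 'e \<times> 'v \<Rightarrow> 'x) \<Rightarrow> 'e measure \<Rightarrow> 'v measure \<Rightarrow> 'u \<Rightarrow> 'x measure \<Rightarrow> 'x measure"
where
  "predict MX G \<nu>\<eta> \<nu>\<epsilon> u \<mu> =
     measure_of (space MX) (sets MX) (\<lambda>C. \<integral>\<^sup>+ x. controlled_kernel G \<nu>\<eta> \<nu>\<epsilon> C x u \<partial>\<mu>)"

definition restricted_predict ::
  "'x measure \<Rightarrow> ('x \<times> 'u \<times> 'e \<times> 'v \<Rightarrow> 'x) \<Rightarrow> 'e measure \<Rightarrow> 'v measure \<Rightarrow> (nat \<Rightarrow> 'x set) \<Rightarrow>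
     'u \<Rightarrow> nat \<Rightarrow> 'x measure \<Rightarrow> 'x measure" where
  "restricted_predict MX G \<nu>\<eta> \<nu>\<epsilon> Obs u j \<mu> =
     measure_of (space MX) (sets MX) (\<lambda>C. emeasure (predict MX G \<nu>\<eta> \<nu>\<epsilon> u \<mu>) (C \<inter> Obs j))"

definition obs_prob ::
  "'x measure \<Rightarrow> ('x \<times> 'u \<times> 'e \<times> 'v \<Rightarrow> 'x) \<Rightarrow> 'e measure \<Rightarrow> 'v measure \<Rightarrow> (nat \<Rightarrow> 'x set) \<Rightarrow>
     nat \<Rightarrow> 'x measure \<Rightarrow> 'u \<Rightarrow> real" where
  "obs_prob MX G \<nu>\<eta> \<nu>\<epsilon> Obs j \<mu> u = measure (predict MX G \<nu>\<eta> \<nu>\<epsilon> u \<mu>) (Obs j)"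

definition filter_update ::
  "'x measure \<Rightarrow> ('x \<times> 'u \<times> 'e \<times> 'v \<Rightarrow> 'x) \<Rightarrow> 'e measure \<Rightarrow> 'v measure \<Rightarrow> (nat \<Rightarrow> 'x set) \<Rightarrow>
     (nat \<Rightarrow> 'x measure) \<Rightarrow> nat \<Rightarrow> 'x measure \<Rightarrow> 'u \<Rightarrow> 'x measure" where
  "filter_update MX G \<nu>\<eta> \<nu>\<epsilon> Obs \<rho> j \<mu> u =
     (if obs_prob MX G \<nu>\<eta> \<nu>\<epsilon> Obs j \<mu> u > 0
      then scale_measure (1 / ennreal (obs_prob MX G \<nu>\<eta> \<nu>\<epsilon> Obs j \<mu> u))
             (restricted_predict MX G \<nu>\<eta> \<nu>\<epsilon> Obs u j \<mu>)
      else \<rho> j)"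


section \<open>Information and conditional laws\<close>

definition history ::
  "'w measure \<Rightarrow> 'u measure \<Rightarrow> (nat \<Rightarrow> 'w \<Rightarrow> nat) \<Rightarrow> (nat \<Rightarrow> 'w \<Rightarrow> 'u) \<Rightarrow> nat \<Rightarrow> 'w measure" where
  "history M MU Y U t =
     sigma (space M)
       ({Y s -` B \<inter> space M | s B. s \<le> t} \<union>
        {U s -` B \<inter> space M | s B. s < t \<and> B \<in> sets MU})"

definition conditional_probability :: "'w measure \<Rightarrow> 'w measure \<Rightarrow> 'w set \<Rightarrow> 'w \<Rightarrow> real" where
  "conditional_probability M F E = real_cond_exp M F (indicator E)"

definition regular_conditional_law ::
  "'w measure \<Rightarrow> 'w measure \<Rightarrow> ('w \<Rightarrow> 'x) \<Rightarrow> 'x measure \<Rightarrow> ('w \<Rightarrow> 'x measure) \<Rightarrow> bool" where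
  "regular_conditional_law M F Z N \<kappa> \<longleftrightarrow>
     \<kappa> \<in> F \<rightarrow>\<^sub>M prob_algebra N \<and>
     (\<forall>C\<in>sets N. AE \<omega> in M.
        measure (\<kappa> \<omega>) C = conditional_probability M F (Z -` C \<inter> space M) \<omega>)"


section \<open>The controlled, partially observed system\<close>

text \<open>
  The noise sequences are indexed from 1; \<open>\<eta> 0\<close> and \<open>\<epsilon> 0\<close> are irrelevant. Likewise only
  \<open>Obs 1, \<dots>, Obs (r + 1)\<close> are meaningful. The cells \<open>A i\<close>, and hence the classes \<open>Obs j\<close>, may be
  empty; \<open>Y\<close> never takes the index of an empty class. In the mutual independence assumption the
  three \<open>\<sigma>\<close>-algebras are those generated by \<open>X 0\<close> and by the two whole noise sequences.
\<close>

locale partially_observed_system = prob_space M + complete_measure M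
  for M :: "'w measure" +
  fixes MX :: "'x measure" and MU :: "'u measure" and ME :: "'e measure" and MV :: "'v measure"
    and G :: "'x \<times> 'u \<times> 'e \<times> 'v \<Rightarrow> 'x"
    and \<nu>\<eta> :: "'e measure" and \<nu>\<epsilon> :: "'v measure"
    and X :: "nat \<Rightarrow> 'w \<Rightarrow> 'x" and U :: "nat \<Rightarrow> 'w \<Rightarrow> 'u"
    and \<eta> :: "nat \<Rightarrow> 'w \<Rightarrow> 'e" and \<epsilon> :: "nat \<Rightarrow> 'w \<Rightarrow> 'v"
    and m r :: nat and A :: "nat \<Rightarrow> 'x set" and J :: "nat \<Rightarrow> nat set"
    and Obs :: "nat \<Rightarrow> 'x set" and Y :: "nat \<Rightarrow> 'w \<Rightarrow> nat"
  assumes standard_borel_spaces: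
      "standard_borel MX" "standard_borel MU" "standard_borel ME" "standard_borel MV"
    and measurable_G: "G \<in> MX \<Otimes>\<^sub>M MU \<Otimes>\<^sub>M ME \<Otimes>\<^sub>M MV \<rightarrow>\<^sub>M MX"
    and noise_laws: "\<nu>\<eta> \<in> space (prob_algebra ME)" "\<nu>\<epsilon> \<in> space (prob_algebra MV)"
    and iid_\<eta>: "indep_vars (\<lambda>_. ME) \<eta> {1..}" "\<And>t. t \<ge> 1 \<Longrightarrow> distr M ME (\<eta> t) = \<nu>\<eta>"
    and iid_\<epsilon>: "indep_vars (\<lambda>_. MV) \<epsilon> {1..}" "\<And>t. t \<ge> 1 \<Longrightarrow> distr M MV (\<epsilon> t) = \<nu>\<epsilon>"
    and measurable_X0: "X 0 \<in> M \<rightarrow>\<^sub>M MX"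
    and mutually_independent:
      "indep_sets
         (\<lambda>k::nat.
            if k = 0 then sets (vimage_algebra (space M) (X 0) MX)
            else if k = 1 then
              sets (vimage_algebra (space M) (\<lambda>\<omega>. \<lambda>t\<in>{1..}. \<eta> t \<omega>) (Pi\<^sub>M {1..} (\<lambda>_. ME)))
            else
              sets (vimage_algebra (space M) (\<lambda>\<omega>. \<lambda>t\<in>{1..}. \<epsilon> t \<omega>) (Pi\<^sub>M {1..} (\<lambda>_. MV))))
         {0, 1, 2}"
    and dynamics:
      "\<And>t \<omega>. \<omega> \<in> space M \<Longrightarrow>
         X (Suc t) \<omega> = G (X t \<omega>, U t \<omega>, \<eta> (Suc t) \<omega>, \<epsilon> (Suc t) \<omega>)"
    and partition_A:
      "\<And>i. i \<in> {1..m} \<Longrightarrow> A i \<in> sets MX" "disjoint_family_on A {1..m}"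
      "(\<Union>i\<in>{1..m}. A i) = space MX"
    and index_sets_J:
      "\<And>j. j \<in> {1..r} \<Longrightarrow> J j \<noteq> {} \<and> J j \<subseteq> {1..m}" "disjoint_family_on J {1..r}"
    and classes_Obs:
      "\<And>j. j \<in> {1..r} \<Longrightarrow> Obs j = (\<Union>i\<in>J j. A i)"
      "Obs (r + 1) = space MX - (\<Union>j\<in>{1..r}. Obs j)"
    and observation:
      "\<And>t \<omega> j. \<omega> \<in> space M \<Longrightarrow> j \<in> {1..r + 1} \<Longrightarrow> Y t \<omega> = j \<longleftrightarrow> X t \<omega> \<in> Obs j"
    and admissible: "\<And>t. U t \<in> history M MU Y U t \<rightarrow>\<^sub>M MU"


section \<open>The filter operators are given by the intended set functions\<close>

lemma emeasure_predict:
  assumes G: "G \<in> MX \<Otimes>\<^sub>M MU \<Otimes>\<^sub>M ME \<Otimes>\<^sub>M MV \<rightarrow>\<^sub>M MX"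
    and \<nu>: "\<nu>\<eta> \<in> space (prob_algebra ME)" "\<nu>\<epsilon> \<in> space (prob_algebra MV)"
    and \<mu>: "\<mu> \<in> space (prob_algebra MX)" and u: "u \<in> space MU" and C: "C \<in> sets MX"
  shows "emeasure (predict MX G \<nu>\<eta> \<nu>\<epsilon> u \<mu>) C = (\<integral>\<^sup>+ x. controlled_kernel G \<nu>\<eta> \<nu>\<epsilon> C x u \<partial>\<mu>)"
proof -
  interpret H: prob_space \<nu>\<eta> using \<nu> by (simp add: space_prob_algebra)
  interpret E: prob_space \<nu>\<epsilon> using \<nu> by (simp add: space_prob_algebra)
  have [measurable_cong]: "sets \<nu>\<eta> = sets ME" "sets \<nu>\<epsilon> = sets MV" "sets \<mu> = sets MX"
    using \<nu> \<mu> by (simp_all add: space_prob_algebra)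
  note [measurable] = G
  have sp: "space \<mu> = space MX" "space \<nu>\<eta> = space ME" "space \<nu>\<epsilon> = space MV"
    using \<nu> \<mu> by (auto simp: space_prob_algebra dest: sets_eq_imp_space_eq)
  have inner: "(\<lambda>(x, e). \<integral>\<^sup>+ v. indicator D (G (x, u, e, v)) \<partial>\<nu>\<epsilon>)
      \<in> borel_measurable (\<mu> \<Otimes>\<^sub>M \<nu>\<eta>)" if [measurable]: "D \<in> sets MX" for D :: "'a set"
    using u by measurable
  have outer: "(\<lambda>x. controlled_kernel G \<nu>\<eta> \<nu>\<epsilon> D x u) \<in> borel_measurable \<mu>"
    if [measurable]: "D \<in> sets MX" for D :: "'a set"
    unfolding controlled_kernel_def using H.borel_measurable_nn_integral[OF inner[OF that]]
    by (simp add: case_prod_beta)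
  have "countably_additive (sets MX) (\<lambda>D. \<integral>\<^sup>+ x. controlled_kernel G \<nu>\<eta> \<nu>\<epsilon> D x u \<partial>\<mu>)"
  proof (rule countably_additiveI)
    fix B :: "nat \<Rightarrow> 'a set"
    assume B: "range B \<subseteq> sets MX" "disjoint_family B"
    then have [measurable]: "B i \<in> sets MX" for i by auto
    have "(\<integral>\<^sup>+ x. controlled_kernel G \<nu>\<eta> \<nu>\<epsilon> (\<Union>i. B i) x u \<partial>\<mu>)
        = (\<integral>\<^sup>+ x. (\<Sum>i. controlled_kernel G \<nu>\<eta> \<nu>\<epsilon> (B i) x u) \<partial>\<mu>)"
    proof (rule nn_integral_cong)
      fix x assume "x \<in> space \<mu>"
      then have x: "x \<in> space MX" by (simp add: sp)
      have "(\<integral>\<^sup>+ v. indicator (\<Union>i. B i) (G (x, u, e, v)) \<partial>\<nu>\<epsilon>)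
          = (\<Sum>i. \<integral>\<^sup>+ v. indicator (B i) (G (x, u, e, v)) \<partial>\<nu>\<epsilon>)" if "e \<in> space \<nu>\<eta>" for e
      proof -
        have e: "e \<in> space ME" using that by (simp add: sp)
        have "(\<integral>\<^sup>+ v. indicator (\<Union>i. B i) (G (x, u, e, v)) \<partial>\<nu>\<epsilon>)
            = (\<integral>\<^sup>+ v. (\<Sum>i. indicator (B i) (G (x, u, e, v))) \<partial>\<nu>\<epsilon>)"
          by (simp add: suminf_indicator[OF B(2)])
        also have "\<dots> = (\<Sum>i. \<integral>\<^sup>+ v. indicator (B i) (G (x, u, e, v)) \<partial>\<nu>\<epsilon>)"
          using x e u by (intro nn_integral_suminf) measurable
        finally show ?thesis .
      qed
      then have "controlled_kernel G \<nu>\<eta> \<nu>\<epsilon> (\<Union>i. B i) x u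
          = (\<integral>\<^sup>+ e. (\<Sum>i. \<integral>\<^sup>+ v. indicator (B i) (G (x, u, e, v)) \<partial>\<nu>\<epsilon>) \<partial>\<nu>\<eta>)"
        unfolding controlled_kernel_def by (intro nn_integral_cong) simp
      also have "\<dots> = (\<Sum>i. controlled_kernel G \<nu>\<eta> \<nu>\<epsilon> (B i) x u)"
        unfolding controlled_kernel_def using x u
        by (intro nn_integral_suminf) measurable
      finally show "controlled_kernel G \<nu>\<eta> \<nu>\<epsilon> (\<Union>i. B i) x u
          = (\<Sum>i. controlled_kernel G \<nu>\<eta> \<nu>\<epsilon> (B i) x u)" .
    qed
    also have "\<dots> = (\<Sum>i. \<integral>\<^sup>+ x. controlled_kernel G \<nu>\<eta> \<nu>\<epsilon> (B i) x u \<partial>\<mu>)"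
      by (intro nn_integral_suminf outer) measurable
    finally show "(\<Sum>i. \<integral>\<^sup>+ x. controlled_kernel G \<nu>\<eta> \<nu>\<epsilon> (B i) x u \<partial>\<mu>)
        = (\<integral>\<^sup>+ x. controlled_kernel G \<nu>\<eta> \<nu>\<epsilon> (\<Union>i. B i) x u \<partial>\<mu>)" by simp
  qed
  moreover have "positive (sets MX) (\<lambda>D. \<integral>\<^sup>+ x. controlled_kernel G \<nu>\<eta> \<nu>\<epsilon> D x u \<partial>\<mu>)"
    by (simp add: positive_def controlled_kernel_def)
  ultimately show ?thesis
    unfolding predict_def using C
    by (intro emeasure_measure_of_sigma) (auto intro: sets.sigma_algebra_axioms)
qed

lemma emeasure_restricted_predict:
  assumes "Obs j \<in> sets MX" and C: "C \<in> sets MX"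
  shows "emeasure (restricted_predict MX G \<nu>\<eta> \<nu>\<epsilon> Obs u j \<mu>) C
       = emeasure (predict MX G \<nu>\<eta> \<nu>\<epsilon> u \<mu>) (C \<inter> Obs j)"
proof -
  let ?L = "predict MX G \<nu>\<eta> \<nu>\<epsilon> u \<mu>"
  have L: "sets ?L = sets MX" by (simp add: predict_def sets.sigma_sets_eq)
  have "countably_additive (sets MX) (\<lambda>C. emeasure ?L (C \<inter> Obs j))"
  proof (rule countably_additiveI)
    fix B :: "nat \<Rightarrow> 'a set"
    assume B: "range B \<subseteq> sets MX" "disjoint_family B"
    have "(\<Sum>i. emeasure ?L (B i \<inter> Obs j)) = emeasure ?L (\<Union>i. B i \<inter> Obs j)"
      using B assms by (intro suminf_emeasure) (auto simp: L disjoint_family_on_def)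
    then show "(\<Sum>i. emeasure ?L (B i \<inter> Obs j)) = emeasure ?L ((\<Union>i. B i) \<inter> Obs j)"
      by simp
  qed
  moreover have "positive (sets MX) (\<lambda>C. emeasure ?L (C \<inter> Obs j))"
    by (simp add: positive_def)
  ultimately show ?thesis
    unfolding restricted_predict_def using C
    by (intro emeasure_measure_of_sigma) (auto intro: sets.sigma_algebra_axioms)
qed

end

theory Submission
  imports Defs
begin

text \<open>
  The filter recursion consists of two applications of one principle and of a uniqueness argument.

  The principle is disintegration. Saying that a kernel \<open>\<kappa>\<close> is a conditional law of \<open>Z\<close> given \<open>F\<close> is
  the same as the identity \<open>\<P>(Z \<in> C, D) = E[\<kappa>(C); D]\<close> for \<open>C\<close> measurable and \<open>D \<in> F\<close>, and this extends
  from rectangles to \<open>E[h(Z, \<omega>)] = E[\<integral> h(x, \<omega>) \<kappa>(\<omega>, dx)]\<close> for all jointly measurable \<open>h \<ge> 0\<close>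
  (\<open>nn_integral_disintegrates\<close>). Independence is the special case of a constant kernel, so the usual
  freezing lemma is an instance.

  Prediction (\<open>disintegrates_prediction\<close>). The state \<open>X t\<close>, the control \<open>U t\<close> and the history up to \<open>t\<close>
  are functions of the initial state and of the noises with index at most \<open>t\<close>, while the pair of
  noises with index \<open>t + 1\<close> is independent of these. Integrating out the new noise pair turns
  \<open>\<P>(X (t + 1) \<in> C, D)\<close> into \<open>E[Q(C | X t, U t); D]\<close>, and integrating out \<open>X t\<close> given the history
  turns this into \<open>E[(L \<pi>)(C); D]\<close>, where \<open>L\<close> is the prediction operator for the control \<open>U t\<close>.

  Correction (\<open>disintegrates_update\<close>). On the event \<open>Y (t + 1) = j\<close> the history at time \<open>t + 1\<close>
  has no more events than the history at time \<open>t\<close> (\<open>history_trace_on_observation\<close>). Hence the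
  defining identity of a conditional law given the new history can be checked one value of \<open>j\<close> at a
  time, against events \<open>D\<close> of the old history. There it reduces to Bayes' rule in the product form
  \<open>\<Phi>\<^sub>j(C) p\<^sub>j = (L \<pi>)(C \<inter> O\<^sub>j)\<close>, which remains true when \<open>p\<^sub>j = 0\<close>, since then both sides vanish.

  Both formulas thus give regular conditional laws. Two regular conditional laws agree almost
  surely on each measurable set, and in a standard Borel space countably many sets determine a
  probability measure, so they agree almost surely as measures
  (\<open>regular_conditional_law_AE_unique\<close>).
\<close>

section \<open>Conditional laws as disintegrations\<close>

text \<open>
  The integral form of a regular conditional law, free of conditional expectations: it speaks of
  integrals over events, which can be rewritten by equalities, instead of almost sure versions.
\<close>

definition disintegrates ::
  "'w measure \<Rightarrow> 'w measure \<Rightarrow> ('w \<Rightarrow> 'x) \<Rightarrow> 'x measure \<Rightarrow> ('w \<Rightarrow> 'x measure) \<Rightarrow> bool" where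
  "disintegrates M F Z N \<kappa> \<longleftrightarrow>
     \<kappa> \<in> F \<rightarrow>\<^sub>M prob_algebra N \<and>
     (\<forall>C\<in>sets N. \<forall>D\<in>sets F.
        emeasure M (Z -` C \<inter> D) = (\<integral>\<^sup>+ \<omega>\<in>D. emeasure (\<kappa> \<omega>) C \<partial>M))"

lemma disintegratesD:
  assumes "disintegrates M F Z N \<kappa>"
  shows "\<kappa> \<in> F \<rightarrow>\<^sub>M prob_algebra N"
    and "\<And>C D. C \<in> sets N \<Longrightarrow> D \<in> sets F \<Longrightarrow>
           emeasure M (Z -` C \<inter> D) = (\<integral>\<^sup>+ \<omega>\<in>D. emeasure (\<kappa> \<omega>) C \<partial>M)"
  using assms by (auto simp: disintegrates_def)

lemma kernel_valueD:
  assumes "\<kappa> \<in> F \<rightarrow>\<^sub>M prob_algebra N" "\<omega> \<in> space F"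
  shows "\<kappa> \<omega> \<in> space (prob_algebra N)" "prob_space (\<kappa> \<omega>)" "sets (\<kappa> \<omega>) = sets N"
  using measurable_space[OF assms] by (auto simp: space_prob_algebra)

lemma borel_measurable_emeasure_kernel:
  assumes "\<kappa> \<in> F \<rightarrow>\<^sub>M prob_algebra N" "C \<in> sets N"
  shows "(\<lambda>\<omega>. emeasure (\<kappa> \<omega>) C) \<in> borel_measurable F"
  using measurable_emeasure_subprob_algebra[OF assms(2)] measurable_prob_algebraD[OF assms(1)]
  by (rule measurable_compose[rotated])

text \<open>
  Conditional expectation is characterised by its integrals over the events of \<open>F\<close>; the only work is
  the passage between Bochner integrals of probabilities and nonnegative integrals.
\<close>

lemma (in prob_space) disintegrates_iff_regular_conditional_law:
  assumes sub: "subalgebra M F" and Z[measurable]: "Z \<in> M \<rightarrow>\<^sub>M N"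
  shows "disintegrates M F Z N \<kappa> \<longleftrightarrow> regular_conditional_law M F Z N \<kappa>"
proof (cases "\<kappa> \<in> F \<rightarrow>\<^sub>M prob_algebra N")
  case \<kappa>: True
  interpret S: finite_measure_subalgebra M F by unfold_locales (rule sub)
  have sp: "space F = space M" and FM: "\<And>D. D \<in> sets F \<Longrightarrow> D \<in> sets M"
    using sub by (auto simp: subalgebra_def)
  have key: "(\<forall>D\<in>sets F. emeasure M (Z -` C \<inter> D) = (\<integral>\<^sup>+ \<omega>\<in>D. emeasure (\<kappa> \<omega>) C \<partial>M)) \<longleftrightarrow>
      (AE \<omega> in M. measure (\<kappa> \<omega>) C = conditional_probability M F (Z -` C \<inter> space M) \<omega>)"
    if C[measurable]: "C \<in> sets N" for C
  proof -
    let ?E = "Z -` C \<inter> space M"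
    let ?k = "\<lambda>\<omega>. measure (\<kappa> \<omega>) C"
    let ?e = "indicator ?E :: _ \<Rightarrow> real"
    have kF: "?k \<in> borel_measurable F" using \<kappa> by measurable
    then have [measurable]: "?k \<in> borel_measurable M" by (rule measurable_from_subalg[OF sub])
    have k1: "?k \<omega> \<le> 1" if "\<omega> \<in> space M" for \<omega>
      using kernel_valueD(2)[OF \<kappa>, of \<omega>] that by (auto simp: sp intro: prob_space.prob_le_1)
    have ik: "integrable M ?k"
      by (rule integrable_const_bound[where B=1]) (auto simp: k1 intro!: AE_I2)
    have ie: "integrable M ?e" by (simp add: less_top[symmetric])
    have left: "emeasure M (Z -` C \<inter> D) = ennreal (\<integral>\<omega>\<in>D. ?e \<omega> \<partial>M)"
      if D: "D \<in> sets F" for D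
    proof -
      have [measurable]: "D \<in> sets M" using FM[OF D] .
      have "Z -` C \<inter> D = D \<inter> ?E" using sets.sets_into_space[OF FM[OF D]] by auto
      then show ?thesis
        by (simp add: set_lebesgue_integral_def indicator_inter_arith[symmetric] emeasure_eq_measure)
    qed
    have right: "(\<integral>\<^sup>+ \<omega>\<in>D. emeasure (\<kappa> \<omega>) C \<partial>M) = ennreal (\<integral>\<omega>\<in>D. ?k \<omega> \<partial>M)"
      if D: "D \<in> sets F" for D
    proof -
      have [measurable]: "D \<in> sets M" using FM[OF D] .
      have "(\<integral>\<^sup>+ \<omega>\<in>D. emeasure (\<kappa> \<omega>) C \<partial>M) = (\<integral>\<^sup>+ \<omega>. ennreal (indicator D \<omega> * ?k \<omega>) \<partial>M)"
      proof (rule nn_integral_cong)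
        fix \<omega> assume "\<omega> \<in> space M"
        then interpret K: prob_space "\<kappa> \<omega>" using kernel_valueD(2)[OF \<kappa>] by (simp add: sp)
        show "emeasure (\<kappa> \<omega>) C * indicator D \<omega> = ennreal (indicator D \<omega> * ?k \<omega>)"
          by (simp add: K.emeasure_eq_measure indicator_def)
      qed
      also have "\<dots> = ennreal (\<integral>\<omega>. indicator D \<omega> * ?k \<omega> \<partial>M)"
        using integrable_mult_indicator[OF \<open>D \<in> sets M\<close> ik]
        by (intro nn_integral_eq_integral) auto
      finally show ?thesis by (simp add: set_lebesgue_integral_def)
    qed
    have nn: "0 \<le> (\<integral>\<omega>\<in>D. ?e \<omega> \<partial>M)" "0 \<le> (\<integral>\<omega>\<in>D. ?k \<omega> \<partial>M)" for D
      by (auto simp: set_lebesgue_integral_def intro!: integral_nonneg_AE)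
    have "(\<forall>D\<in>sets F. emeasure M (Z -` C \<inter> D) = (\<integral>\<^sup>+ \<omega>\<in>D. emeasure (\<kappa> \<omega>) C \<partial>M)) \<longleftrightarrow>
        (\<forall>D\<in>sets F. (\<integral>\<omega>\<in>D. ?e \<omega> \<partial>M) = (\<integral>\<omega>\<in>D. ?k \<omega> \<partial>M))"
      using nn by (intro ball_cong refl) (simp add: left right)
    also have "\<dots> \<longleftrightarrow> (AE \<omega> in M. ?k \<omega> = real_cond_exp M F ?e \<omega>)"
    proof
      assume "\<forall>D\<in>sets F. (\<integral>\<omega>\<in>D. ?e \<omega> \<partial>M) = (\<integral>\<omega>\<in>D. ?k \<omega> \<partial>M)"
      then have "AE \<omega> in M. real_cond_exp M F ?e \<omega> = ?k \<omega>"
        by (intro S.real_cond_exp_charact ie ik kF) auto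
      then show "AE \<omega> in M. ?k \<omega> = real_cond_exp M F ?e \<omega>" by eventually_elim simp
    next
      assume ae: "AE \<omega> in M. ?k \<omega> = real_cond_exp M F ?e \<omega>"
      show "\<forall>D\<in>sets F. (\<integral>\<omega>\<in>D. ?e \<omega> \<partial>M) = (\<integral>\<omega>\<in>D. ?k \<omega> \<partial>M)"
      proof
        fix D assume D: "D \<in> sets F"
        have [measurable]: "D \<in> sets M" using FM[OF D] .
        have [measurable]: "real_cond_exp M F ?e \<in> borel_measurable M" by simp
        have "(\<integral>\<omega>\<in>D. ?e \<omega> \<partial>M) = (\<integral>\<omega>\<in>D. real_cond_exp M F ?e \<omega> \<partial>M)"
          by (rule S.real_cond_exp_intA[OF ie D])
        also have "\<dots> = (\<integral>\<omega>\<in>D. ?k \<omega> \<partial>M)"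
          unfolding set_lebesgue_integral_def using ae by (intro integral_cong_AE) auto
        finally show "(\<integral>\<omega>\<in>D. ?e \<omega> \<partial>M) = (\<integral>\<omega>\<in>D. ?k \<omega> \<partial>M)" .
      qed
    qed
    finally show ?thesis unfolding conditional_probability_def .
  qed
  show ?thesis
    unfolding disintegrates_def regular_conditional_law_def using \<kappa> key by simp
qed (simp add: disintegrates_def regular_conditional_law_def)

text \<open>
  The joint law of \<open>Z\<close> and \<open>\<omega>\<close> on \<open>N \<Otimes>\<^sub>M F\<close> coincides with the mixture of the slices
  \<open>\<kappa>(\<omega>) \<otimes> \<delta>\<^sub>\<omega>\<close>: the hypothesis is equality on rectangles, which form a generator stable under
  intersection. Integrating \<open>h\<close> against both descriptions gives the claim.
\<close>

lemma (in prob_space) nn_integral_disintegrates: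
  assumes sub: "subalgebra M F" and Z[measurable]: "Z \<in> M \<rightarrow>\<^sub>M N"
    and dis: "disintegrates M F Z N \<kappa>"
    and h[measurable]: "(\<lambda>(x, \<omega>). h x \<omega>) \<in> borel_measurable (N \<Otimes>\<^sub>M F)"
  shows "(\<integral>\<^sup>+ \<omega>. h (Z \<omega>) \<omega> \<partial>M) = (\<integral>\<^sup>+ \<omega>. \<integral>\<^sup>+ x. h x \<omega> \<partial>\<kappa> \<omega> \<partial>M)"
proof -
  note \<kappa> = disintegratesD(1)[OF dis]
  note [measurable] = measurable_prob_algebraD[OF \<kappa>]
  let ?R = "restr_to_subalg M F"
  have sp: "space F = space M" and FM: "\<And>D. D \<in> sets F \<Longrightarrow> D \<in> sets M"
    using sub by (auto simp: subalgebra_def)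
  have R[measurable_cong]: "sets ?R = sets F" by (rule sets_restr_to_subalg[OF sub])
  have "(\<lambda>\<omega>. \<omega>) \<in> M \<rightarrow>\<^sub>M F"
    by (rule measurableI) (auto simp: sp dest: FM)
  then have joint: "(\<lambda>\<omega>. (Z \<omega>, \<omega>)) \<in> M \<rightarrow>\<^sub>M N \<Otimes>\<^sub>M F"
    by (rule measurable_Pair[OF Z])
  let ?joint = "distr M (N \<Otimes>\<^sub>M F) (\<lambda>\<omega>. (Z \<omega>, \<omega>))"
  let ?slice = "\<lambda>\<omega>. distr (\<kappa> \<omega>) (N \<Otimes>\<^sub>M F) (\<lambda>x. (x, \<omega>))"
  have slice: "?slice \<in> ?R \<rightarrow>\<^sub>M subprob_algebra (N \<Otimes>\<^sub>M F)"
    by (rule measurable_distr2[where M=N]) measurable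
  have pair: "(\<lambda>x. (x, \<omega>)) \<in> \<kappa> \<omega> \<rightarrow>\<^sub>M N \<Otimes>\<^sub>M F" if "\<omega> \<in> space M" for \<omega>
    using kernel_valueD(3)[OF \<kappa>, of \<omega>] that by (simp add: sp cong: measurable_cong_sets)
  have "?joint = ?R \<bind> ?slice"
  proof (rule measure_eqI_generator_eq)
    let ?E = "{a \<times> b | a b. a \<in> sets N \<and> b \<in> sets F}"
    show "Int_stable ?E" by (rule Int_stable_pair_measure_generator)
    show "?E \<subseteq> Pow (space N \<times> space F)" by (rule pair_measure_closed)
    show "sets ?joint = sigma_sets (space N \<times> space F) ?E" by (simp add: sets_pair_measure)
    have ne: "space ?R \<noteq> {}" by (simp add: space_restr_to_subalg not_empty)
    show "sets (?R \<bind> ?slice) = sigma_sets (space N \<times> space F) ?E"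
      using sets_bind[OF sets_kernel[OF slice] ne] by (simp add: sets_pair_measure)
    show "range (\<lambda>_::nat. space N \<times> space F) \<subseteq> ?E" by blast
    show "(\<Union>i::nat. space N \<times> space F) = space N \<times> space F" by simp
    show "emeasure ?joint (space N \<times> space F) \<noteq> \<infinity>"
      by (subst emeasure_distr[OF joint]) (auto simp: less_top[symmetric])
    fix B assume "B \<in> ?E"
    then obtain C D where B: "B = C \<times> D" and C[measurable]: "C \<in> sets N" and D[measurable]: "D \<in> sets F"
      by blast
    have DM: "D \<subseteq> space M" using sets.sets_into_space[OF D] by (simp add: sp)
    have "emeasure ?joint B = emeasure M (Z -` C \<inter> D)"
      unfolding B by (subst emeasure_distr[OF joint]) (auto intro!: arg_cong[where f="emeasure M"] dest: subsetD[OF DM])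
    also have "\<dots> = (\<integral>\<^sup>+ \<omega>. emeasure (\<kappa> \<omega>) C * indicator D \<omega> \<partial>M)"
      by (rule disintegratesD(2)[OF dis C D])
    also have "\<dots> = (\<integral>\<^sup>+ \<omega>. emeasure (\<kappa> \<omega>) C * indicator D \<omega> \<partial>?R)"
      using borel_measurable_emeasure_kernel[OF \<kappa> C]
      by (intro nn_integral_subalgebra2[symmetric] sub) measurable
    also have "\<dots> = (\<integral>\<^sup>+ \<omega>. emeasure (?slice \<omega>) B \<partial>?R)"
    proof (rule nn_integral_cong)
      fix \<omega> assume "\<omega> \<in> space ?R"
      then have \<omega>: "\<omega> \<in> space M" by (simp add: space_restr_to_subalg)
      have "(\<lambda>x. (x, \<omega>)) -` (C \<times> D) \<inter> space (\<kappa> \<omega>) = (if \<omega> \<in> D then C else {})"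
        using sets.sets_into_space[OF C] sets_eq_imp_space_eq[OF kernel_valueD(3)[OF \<kappa>, of \<omega>]] \<omega>
        by (auto simp: sp)
      then show "emeasure (\<kappa> \<omega>) C * indicator D \<omega> = emeasure (?slice \<omega>) B"
        unfolding B by (subst emeasure_distr[OF pair[OF \<omega>]]) auto
    qed
    also have "\<dots> = emeasure (?R \<bind> ?slice) B"
      unfolding B by (rule emeasure_bind[OF ne slice, symmetric]) simp
    finally show "emeasure ?joint B = emeasure (?R \<bind> ?slice) B" .
  qed
  then have "(\<integral>\<^sup>+ p. (case p of (x, \<omega>) \<Rightarrow> h x \<omega>) \<partial>?joint)
      = (\<integral>\<^sup>+ p. (case p of (x, \<omega>) \<Rightarrow> h x \<omega>) \<partial>(?R \<bind> ?slice))" by simp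
  also have "\<dots> = (\<integral>\<^sup>+ \<omega>. \<integral>\<^sup>+ p. (case p of (x, \<omega>) \<Rightarrow> h x \<omega>) \<partial>?slice \<omega> \<partial>?R)"
    by (rule nn_integral_bind[OF h slice])
  also have "\<dots> = (\<integral>\<^sup>+ \<omega>. \<integral>\<^sup>+ x. h x \<omega> \<partial>\<kappa> \<omega> \<partial>?R)"
    by (intro nn_integral_cong, subst nn_integral_distr[OF pair]) (simp_all add: space_restr_to_subalg)
  also have "\<dots> = (\<integral>\<^sup>+ \<omega>. \<integral>\<^sup>+ x. h x \<omega> \<partial>\<kappa> \<omega> \<partial>M)"
    by (intro nn_integral_subalgebra2 sub nn_integral_measurable_subprob_algebra2[where N=N]) measurable
  finally show ?thesis by (subst (asm) nn_integral_distr[OF joint]) simp_all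
qed

section \<open>Uniqueness of conditional laws on a standard Borel space\<close>

text \<open>
  Finite intersections of members of a countable base remain countably many, and every open set is a
  countable union of base sets. The empty intersection is cut down to the whole space.
\<close>

lemma standard_borel_countable_generator:
  assumes "standard_borel N"
  obtains E where "countable E" "Int_stable E" "E \<subseteq> Pow (space N)" "space N \<in> E"
    "sets N = sigma_sets (space N) E"
proof -
  obtain T where T: "topspace T = space N" "second_countable T"
      "sets N = sigma_sets (topspace T) {S. openin T S}"
    using assms unfolding standard_borel_def by blast
  obtain B where base: "countable B \<and> (\<forall>V\<in>B. openin T V) \<and>
      (\<forall>U x. openin T U \<and> x \<in> U \<longrightarrow> (\<exists>V\<in>B. x \<in> V \<and> V \<subseteq> U))"
    using T(2) unfolding second_countable_def by (elim exE)
  have B: "countable B" "\<And>V. V \<in> B \<Longrightarrow> openin T V"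
      "\<And>U x. openin T U \<Longrightarrow> x \<in> U \<Longrightarrow> \<exists>V\<in>B. x \<in> V \<and> V \<subseteq> U"
    using base by simp_all
  \<comment> \<open>Closing the base under finite intersections makes it a generator stable under intersection.\<close>
  define E where "E = (\<lambda>K. space N \<inter> \<Inter>K) ` {K. finite K \<and> K \<subseteq> B}"
  have "countable E"
    unfolding E_def by (intro countable_image countable_Collect_finite_subset B)
  moreover have "Int_stable E"
  proof (rule Int_stableI)
    fix a b assume "a \<in> E" "b \<in> E"
    then obtain K L where "a = space N \<inter> \<Inter>K" "b = space N \<inter> \<Inter>L"
        "finite K" "K \<subseteq> B" "finite L" "L \<subseteq> B"
      by (auto simp: E_def)
    then have "a \<inter> b = space N \<inter> \<Inter>(K \<union> L)" "K \<union> L \<in> {K. finite K \<and> K \<subseteq> B}" by auto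
    then show "a \<inter> b \<in> E" unfolding E_def by blast
  qed
  moreover have "E \<subseteq> Pow (space N)" by (auto simp: E_def)
  moreover have "space N \<in> E" unfolding E_def by (auto intro!: image_eqI[of _ _ "{}"])
  moreover have "sets N = sigma_sets (space N) E"
  proof
    interpret S: sigma_algebra "space N" "sigma_sets (space N) E"
      by (rule sigma_algebra_sigma_sets) (auto simp: E_def)
    have BE: "V \<in> sigma_sets (space N) E" if "V \<in> B" for V
    proof -
      have "V = space N \<inter> \<Inter>{V}" using openin_subset[OF B(2)[OF that]] by (auto simp: T(1))
      then have "V \<in> E" unfolding E_def using that by blast
      then show ?thesis by (rule sigma_sets.Basic)
    qed
    have "U \<in> sigma_sets (space N) E" if U: "openin T U" for U
    proof -
      have "U = \<Union>{V\<in>B. V \<subseteq> U}" using B(3)[OF U] by blast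
      moreover have "\<Union>{V\<in>B. V \<subseteq> U} \<in> sigma_sets (space N) E"
        using B(1) BE by (intro S.countable_Union) auto
      ultimately show ?thesis by simp
    qed
    then show "sets N \<subseteq> sigma_sets (space N) E"
      unfolding T(3) T(1) by (intro S.sigma_sets_subset) auto
    have "space N \<inter> \<Inter>K \<in> sets N" if "finite K" "K \<subseteq> B" for K
      using that
    proof (induction K)
      case (insert V K)
      have "V \<in> sets N" using insert B(2)[of V] by (auto simp: T(3) intro: sigma_sets.Basic)
      with insert have "V \<inter> (space N \<inter> \<Inter>K) \<in> sets N" by (intro sets.Int[of V]) auto
      also have "V \<inter> (space N \<inter> \<Inter>K) = space N \<inter> \<Inter>(insert V K)" by auto
      finally show ?case .
    qed simp
    then have "E \<subseteq> sets N" unfolding E_def by blast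
    then show "sigma_sets (space N) E \<subseteq> sets N" by (rule sets.sigma_sets_subset)
  qed
  ultimately show ?thesis by (rule that)
qed

text \<open>
  On each set of the countable generator the two kernels agree off a null set; the countable union
  of these null sets serves all generators at once.
\<close>

lemma regular_conditional_law_AE_unique:
  assumes std: "standard_borel N" and sp: "space F = space M"
    and \<kappa>: "regular_conditional_law M F Z N \<kappa>" and \<kappa>2: "regular_conditional_law M F Z N \<kappa>'"
  shows "AE \<omega> in M. \<kappa> \<omega> = \<kappa>' \<omega>"
proof -
  obtain E where E: "countable E" "Int_stable E" "E \<subseteq> Pow (space N)" "space N \<in> E"
      "sets N = sigma_sets (space N) E"
    using standard_borel_countable_generator[OF std] .
  have "AE \<omega> in M. measure (\<kappa> \<omega>) C = measure (\<kappa>' \<omega>) C" if "C \<in> E" for C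
  proof -
    have "C \<in> sets N" using that E(5) by auto
    then have "AE \<omega> in M. measure (\<kappa> \<omega>) C = conditional_probability M F (Z -` C \<inter> space M) \<omega>"
      "AE \<omega> in M. measure (\<kappa>' \<omega>) C = conditional_probability M F (Z -` C \<inter> space M) \<omega>"
      using \<kappa> \<kappa>2 by (auto simp: regular_conditional_law_def)
    then show ?thesis by eventually_elim simp
  qed
  then have "AE \<omega> in M. \<forall>C\<in>E. measure (\<kappa> \<omega>) C = measure (\<kappa>' \<omega>) C"
    by (simp add: AE_ball_countable E(1))
  moreover have "AE \<omega> in M. \<omega> \<in> space M" by (rule AE_space)
  ultimately show ?thesis
  proof eventually_elim
    case (elim \<omega>)
    have "\<kappa> \<in> F \<rightarrow>\<^sub>M prob_algebra N" "\<kappa>' \<in> F \<rightarrow>\<^sub>M prob_algebra N"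
      using \<kappa> \<kappa>2 by (auto simp: regular_conditional_law_def)
    note K = kernel_valueD(2,3)[OF this(1), of \<omega>] and L = kernel_valueD(2,3)[OF this(2), of \<omega>]
    interpret K: prob_space "\<kappa> \<omega>" using K elim by (simp add: sp)
    interpret L: prob_space "\<kappa>' \<omega>" using L elim by (simp add: sp)
    show ?case
    proof (rule measure_eqI_generator_eq[OF E(2,3), where A="\<lambda>_. space N"])
      show "emeasure (\<kappa> \<omega>) C = emeasure (\<kappa>' \<omega>) C" if "C \<in> E" for C
        using elim that by (simp add: K.emeasure_eq_measure L.emeasure_eq_measure)
    qed (use K L E(4,5) elim sp in auto)
  qed
qed

section \<open>The initial state and the individual noises are independent sources\<close>

lemma Int_stable_vimages: "Int_stable {f -` B \<inter> S | B. B \<in> sets N}"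
proof (rule Int_stableI)
  fix a b assume "a \<in> {f -` B \<inter> S | B. B \<in> sets N}" "b \<in> {f -` B \<inter> S | B. B \<in> sets N}"
  then obtain B C where "a = f -` B \<inter> S" "b = f -` C \<inter> S" "B \<in> sets N" "C \<in> sets N" by blast
  then have "a \<inter> b = f -` (B \<inter> C) \<inter> S" "B \<inter> C \<in> sets N" by auto
  then show "a \<inter> b \<in> {f -` B \<inter> S | B. B \<in> sets N}" by blast
qed

text \<open>
  The independent primitives of the model, so that one independence statement covers all of them and
  subsets of sources can be grouped freely.
\<close>

datatype source = Initial | Eta nat | Eps nat

lemma measurable_mono_space:
  assumes "f \<in> F \<rightarrow>\<^sub>M N" "sets F \<subseteq> sets F'" "space F = space F'"
  shows "f \<in> F' \<rightarrow>\<^sub>M N"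
  using assms by (auto simp: measurable_def)

context partially_observed_system
begin

lemma measurable_noise:
  assumes "1 \<le> s"
  shows "\<eta> s \<in> M \<rightarrow>\<^sub>M ME" "\<epsilon> s \<in> M \<rightarrow>\<^sub>M MV"
  using iid_\<eta>(1) iid_\<epsilon>(1) assms by (auto simp: indep_vars_def)

fun source_events :: "source \<Rightarrow> 'w set set" where
  "source_events Initial = {X 0 -` B \<inter> space M | B. B \<in> sets MX}"
| "source_events (Eta s) = {\<eta> s -` B \<inter> space M | B. B \<in> sets ME}"
| "source_events (Eps s) = {\<epsilon> s -` B \<inter> space M | B. B \<in> sets MV}"

definition sources :: "source set" where
  "sources = insert Initial (Eta ` {1..} \<union> Eps ` {1..})"

lemma source_events_subset: "i \<in> sources \<Longrightarrow> source_events i \<subseteq> events"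
  using measurable_X0 measurable_noise by (auto simp: sources_def)

lemma Int_stable_source_events: "Int_stable (source_events i)"
  by (cases i) (simp_all add: Int_stable_vimages)

text \<open>
  Finitely many constraints on single members of an independent sequence form an event of the
  \<open>\<sigma>\<close>-algebra of the whole sequence, which is the one that occurs in the mutual independence
  assumption; its probability factors by independence within the sequence. The intersection with
  the sample space covers the case of no constraint.
\<close>

lemma finite_noise_event:
  fixes \<xi> :: "nat \<Rightarrow> 'w \<Rightarrow> 'n"
  assumes iid: "indep_vars (\<lambda>_. N) \<xi> {1..}"
    and K: "finite K" "K \<subseteq> {1..}"
    and E: "\<And>s. s \<in> K \<Longrightarrow> E s \<in> {\<xi> s -` B \<inter> space M | B. B \<in> sets N}"
  shows "space M \<inter> (\<Inter>s\<in>K. E s)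
      \<in> sets (vimage_algebra (space M) (\<lambda>\<omega>. \<lambda>s\<in>{1..}. \<xi> s \<omega>) (Pi\<^sub>M {1..} (\<lambda>_. N)))"
    and "prob (space M \<inter> (\<Inter>s\<in>K. E s)) = (\<Prod>s\<in>K. prob (E s))"
proof -
  let ?H = "\<lambda>\<omega>. \<lambda>s\<in>{1..}. \<xi> s \<omega>"
  let ?V = "vimage_algebra (space M) ?H (Pi\<^sub>M {1..} (\<lambda>_. N))"
  have \<xi>: "\<xi> s \<in> M \<rightarrow>\<^sub>M N" if "s \<in> {1..}" for s
    using iid that by (auto simp: indep_vars_def)
  have H: "?H \<in> ?V \<rightarrow>\<^sub>M Pi\<^sub>M {1..} (\<lambda>_. N)"
    by (rule measurable_vimage_algebra1) (use measurable_space[OF \<xi>] in \<open>auto simp: space_PiM PiE_iff\<close>)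
  have "E s \<in> sets ?V" if s: "s \<in> K" for s
  proof -
    have s1: "s \<in> {1..}" using s K by auto
    obtain B where B: "E s = \<xi> s -` B \<inter> space M" "B \<in> sets N" using E[OF s] by blast
    have "(\<lambda>\<omega>. ?H \<omega> s) \<in> ?V \<rightarrow>\<^sub>M N"
      using H by (rule measurable_compose) (rule measurable_component_singleton[OF s1])
    then have "\<xi> s \<in> ?V \<rightarrow>\<^sub>M N" using s1 by simp
    from measurable_sets[OF this B(2)] show ?thesis by (simp add: B(1))
  qed
  then show "space M \<inter> (\<Inter>s\<in>K. E s) \<in> sets ?V"
    using sets.top[of ?V] K(1) by (cases "K = {}") (auto intro!: sets.Int sets.finite_INT)
  show "prob (space M \<inter> (\<Inter>s\<in>K. E s)) = (\<Prod>s\<in>K. prob (E s))"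
  proof (cases "K = {}")
    case False
    have ind: "indep_sets (\<lambda>s. {\<xi> s -` B \<inter> space M | B. B \<in> sets N}) {1..}"
      using iid by (simp add: indep_vars_def2)
    have "space M \<inter> (\<Inter>s\<in>K. E s) = (\<Inter>s\<in>K. E s)" using E False by blast
    with indep_setsD[OF ind K(2) False K(1), of E] E show ?thesis by auto
  qed (simp add: prob_space)
qed

text \<open>
  A finite intersection of source events splits into an event of \<open>X 0\<close>, one of the \<open>\<eta>\<close>-sequence and
  one of the \<open>\<epsilon>\<close>-sequence. Mutual independence separates the three, and independence within each
  sequence separates the rest.
\<close>

lemma indep_sources: "indep_sets source_events sources"
proof (rule indep_setsI)
  show "source_events i \<subseteq> events" if "i \<in> sources" for i
    using that by (rule source_events_subset)
next
  fix E L assume L: "L \<noteq> {}" "L \<subseteq> sources" "finite L" and E: "\<forall>i\<in>L. E i \<in> source_events i"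
  let ?K = "{s. Eta s \<in> L}" and ?K' = "{s. Eps s \<in> L}"
  define a where "a = (if Initial \<in> L then E Initial else space M)"
  define b where "b = space M \<inter> (\<Inter>s\<in>?K. E (Eta s))"
  define c where "c = space M \<inter> (\<Inter>s\<in>?K'. E (Eps s))"
  have fin: "finite ?K" "finite ?K'"
    using finite_vimageI[OF L(3), of Eta] finite_vimageI[OF L(3), of Eps]
    by (auto simp: inj_on_def vimage_def)
  have sub: "?K \<subseteq> {1..}" "?K' \<subseteq> {1..}" using L(2) by (auto simp: sources_def)
  have EM: "E i \<subseteq> space M" if "i \<in> L" for i
    using E that source_events_subset L(2) sets.sets_into_space by blast
  have bs: "b \<in> sets (vimage_algebra (space M) (\<lambda>\<omega>. \<lambda>s\<in>{1..}. \<eta> s \<omega>) (Pi\<^sub>M {1..} (\<lambda>_. ME)))"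
    and bp: "prob b = (\<Prod>s\<in>?K. prob (E (Eta s)))"
    unfolding b_def using E by (intro finite_noise_event[OF iid_\<eta>(1) fin(1) sub(1)]; force)+
  have cs: "c \<in> sets (vimage_algebra (space M) (\<lambda>\<omega>. \<lambda>s\<in>{1..}. \<epsilon> s \<omega>) (Pi\<^sub>M {1..} (\<lambda>_. MV)))"
    and cp: "prob c = (\<Prod>s\<in>?K'. prob (E (Eps s)))"
    unfolding c_def using E by (intro finite_noise_event[OF iid_\<epsilon>(1) fin(2) sub(2)]; force)+
  have as: "a \<in> sets (vimage_algebra (space M) (X 0) MX)"
  proof (cases "Initial \<in> L")
    case True
    then obtain B where "a = X 0 -` B \<inter> space M" "B \<in> sets MX" using bspec[OF E True] by (auto simp: a_def)
    then show ?thesis by (simp add: in_vimage_algebra)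
  next
    case False
    then show ?thesis using sets.top[of "vimage_algebra (space M) (X 0) MX"] by (simp add: a_def)
  qed
  have "(\<Inter>i\<in>L. E i) = a \<inter> b \<inter> c"
  proof (intro equalityI subsetI)
    fix \<omega> assume \<omega>: "\<omega> \<in> (\<Inter>i\<in>L. E i)"
    then have "\<omega> \<in> space M" using L(1) EM by blast
    then show "\<omega> \<in> a \<inter> b \<inter> c" using \<omega> by (auto simp: a_def b_def c_def)
  next
    fix \<omega> assume \<omega>: "\<omega> \<in> a \<inter> b \<inter> c"
    have "\<omega> \<in> E i" if "i \<in> L" for i
      using \<omega> that by (cases i) (auto simp: a_def b_def c_def)
    then show "\<omega> \<in> (\<Inter>i\<in>L. E i)" by blast
  qed
  also have "prob (a \<inter> b \<inter> c) = prob a * prob b * prob c"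
    using indep_setsD[OF mutually_independent, of "{0,1,2}" "\<lambda>k. if k = 0 then a else if k = 1 then b else c"]
      as bs cs by (simp add: ac_simps)
  also have "\<dots> = (\<Prod>i\<in>L. prob (E i))"
  proof -
    have Ldec: "L = (L \<inter> {Initial}) \<union> (Eta ` ?K \<union> Eps ` ?K')"
    proof (intro equalityI subsetI)
      fix i assume "i \<in> L" then show "i \<in> (L \<inter> {Initial}) \<union> (Eta ` ?K \<union> Eps ` ?K')"
        by (cases i) auto
    qed auto
    have "(\<Prod>i\<in>L. prob (E i)) = (\<Prod>i\<in>L \<inter> {Initial}. prob (E i)) * (\<Prod>i\<in>Eta ` ?K \<union> Eps ` ?K'. prob (E i))"
      by (subst Ldec, rule prod.union_disjoint) (use fin L(3) in auto)
    also have "(\<Prod>i\<in>Eta ` ?K \<union> Eps ` ?K'. prob (E i)) = prob b * prob c"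
      unfolding bp cp using fin
      by (subst prod.union_disjoint) (auto simp: prod.reindex inj_on_def)
    also have "(\<Prod>i\<in>L \<inter> {Initial}. prob (E i)) = prob a"
      by (cases "Initial \<in> L") (simp_all add: a_def prob_space)
    finally show ?thesis by simp
  qed
  finally show "prob (\<Inter>i\<in>L. E i) = (\<Prod>i\<in>L. prob (E i))" .
qed

section \<open>The next noise is independent of the past\<close>

definition past_sources :: "nat \<Rightarrow> source set" where
  "past_sources t = insert Initial (Eta ` {1..t} \<union> Eps ` {1..t})"

text \<open>
  The \<open>\<sigma>\<close>-algebra of everything that drives the system up to time \<open>t\<close>. In general it contains
  more than the observer knows; it is the algebra from which the next noise pair is independent.
\<close>

definition past :: "nat \<Rightarrow> 'w measure" where
  "past t = sigma (space M) (\<Union>i\<in>past_sources t. source_events i)"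

lemma past_sources_subset: "past_sources t \<subseteq> sources"
  by (auto simp: past_sources_def sources_def)

lemma space_past [simp]: "space (past t) = space M"
  by (simp add: past_def space_measure_of_conv)

lemma past_generators: "(\<Union>i\<in>past_sources t. source_events i) \<subseteq> events"
  using source_events_subset past_sources_subset by (intro UN_least) (rule source_events_subset, rule subsetD)

lemma sets_past: "sets (past t) = sigma_sets (space M) (\<Union>i\<in>past_sources t. source_events i)"
  unfolding past_def
  using past_generators[of t] sets.space_closed[of M] by (intro sets_measure_of) (rule order_trans)

lemma subalgebra_past: "subalgebra M (past t)"
  unfolding subalgebra_def sets_past
  using sets.sigma_sets_subset[OF past_generators] by simp

lemma past_mono: "s \<le> t \<Longrightarrow> sets (past s) \<subseteq> sets (past t)"
  unfolding sets_past 
  by (intro sigma_sets_mono' UN_mono) (auto simp: past_sources_def)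

lemma measurable_past_sources:
  "X 0 \<in> past t \<rightarrow>\<^sub>M MX"
  "1 \<le> s \<Longrightarrow> s \<le> t \<Longrightarrow> \<eta> s \<in> past t \<rightarrow>\<^sub>M ME"
  "1 \<le> s \<Longrightarrow> s \<le> t \<Longrightarrow> \<epsilon> s \<in> past t \<rightarrow>\<^sub>M MV"
proof -
  show "X 0 \<in> past t \<rightarrow>\<^sub>M MX"
    using measurable_space[OF measurable_X0]
    by (intro measurableI)
       (auto simp: sets_past past_sources_def intro!: sigma_sets.Basic)
  assume s: "1 \<le> s" "s \<le> t"
  show "\<eta> s \<in> past t \<rightarrow>\<^sub>M ME"
    using measurable_space[OF measurable_noise(1)[OF s(1)]] s
    by (intro measurableI)
       (auto simp: sets_past past_sources_def intro!: sigma_sets.Basic bexI[of _ s])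
  show "\<epsilon> s \<in> past t \<rightarrow>\<^sub>M MV"
    using measurable_space[OF measurable_noise(2)[OF s(1)]] s
    by (intro measurableI)
       (auto simp: sets_past past_sources_def intro!: sigma_sets.Basic bexI[of _ s])
qed

definition noise_law :: "('e \<times> 'v) measure" where
  "noise_law = \<nu>\<eta> \<Otimes>\<^sub>M \<nu>\<epsilon>"

lemma prob_space_noises: "prob_space \<nu>\<eta>" "prob_space \<nu>\<epsilon>"
  and sets_noises [measurable_cong]: "sets \<nu>\<eta> = sets ME" "sets \<nu>\<epsilon> = sets MV"
  using noise_laws by (simp_all add: space_prob_algebra)

lemma sets_noise_law [measurable_cong]: "sets noise_law = sets (ME \<Otimes>\<^sub>M MV)"
  unfolding noise_law_def by (intro sets_pair_measure_cong sets_noises)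

lemma prob_space_noise_law: "prob_space noise_law"
proof -
  interpret H: prob_space \<nu>\<eta> by (rule prob_space_noises)
  interpret E: prob_space \<nu>\<epsilon> by (rule prob_space_noises)
  interpret P: pair_prob_space \<nu>\<eta> \<nu>\<epsilon> ..
  show ?thesis unfolding noise_law_def by (rule P.prob_space_axioms)
qed

lemma measurable_next_noise: "(\<lambda>\<omega>. (\<eta> (Suc t) \<omega>, \<epsilon> (Suc t) \<omega>)) \<in> M \<rightarrow>\<^sub>M ME \<Otimes>\<^sub>M MV"
  using measurable_noise[of "Suc t"] by simp

lemma distr_next_noise:
  "distr M (ME \<Otimes>\<^sub>M MV) (\<lambda>\<omega>. (\<eta> (Suc t) \<omega>, \<epsilon> (Suc t) \<omega>)) = noise_law"
  unfolding noise_law_def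
proof (rule pair_measure_eqI[symmetric])
  show "sigma_finite_measure \<nu>\<eta>" "sigma_finite_measure \<nu>\<epsilon>"
    using prob_space_noises by (auto intro: prob_space_imp_sigma_finite)
  show "sets (\<nu>\<eta> \<Otimes>\<^sub>M \<nu>\<epsilon>) = sets (distr M (ME \<Otimes>\<^sub>M MV) (\<lambda>\<omega>. (\<eta> (Suc t) \<omega>, \<epsilon> (Suc t) \<omega>)))"
    using sets_noise_law by (simp add: noise_law_def)
  fix B C assume "B \<in> sets \<nu>\<eta>" "C \<in> sets \<nu>\<epsilon>"
  then have B: "B \<in> sets ME" and C: "C \<in> sets MV" by (simp_all add: sets_noises)
  note \<xi> = measurable_noise[of "Suc t", simplified]
  let ?b = "\<eta> (Suc t) -` B \<inter> space M" and ?c = "\<epsilon> (Suc t) -` C \<inter> space M"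
  have "emeasure \<nu>\<eta> B = emeasure M ?b"
    using emeasure_distr[OF \<xi>(1) B] by (simp add: iid_\<eta>(2))
  moreover have "emeasure \<nu>\<epsilon> C = emeasure M ?c"
    using emeasure_distr[OF \<xi>(2) C] by (simp add: iid_\<epsilon>(2))
  moreover have "prob (?b \<inter> ?c) = prob ?b * prob ?c"
    using indep_setsD[OF indep_sources, of "{Eta (Suc t), Eps (Suc t)}" "case_source {} (\<lambda>_. ?b) (\<lambda>_. ?c)"] B C
    by (auto simp: sources_def)
  moreover have "(\<lambda>\<omega>. (\<eta> (Suc t) \<omega>, \<epsilon> (Suc t) \<omega>)) -` (B \<times> C) \<inter> space M = ?b \<inter> ?c" by auto
  ultimately show "emeasure \<nu>\<eta> B * emeasure \<nu>\<epsilon> C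
      = emeasure (distr M (ME \<Otimes>\<^sub>M MV) (\<lambda>\<omega>. (\<eta> (Suc t) \<omega>, \<epsilon> (Suc t) \<omega>))) (B \<times> C)"
    using B C by (simp add: emeasure_distr[OF measurable_next_noise] emeasure_eq_measure ennreal_mult)
qed

text \<open>
  Independence of the next noise pair from the past, in the form of a constant conditional law. The
  sources up to \<open>t\<close> and the two sources with index \<open>t + 1\<close> are disjoint groups, so the
  \<open>\<sigma>\<close>-algebras that they generate are independent.
\<close>

lemma disintegrates_next_noise:
  "disintegrates M (past t) (\<lambda>\<omega>. (\<eta> (Suc t) \<omega>, \<epsilon> (Suc t) \<omega>)) (ME \<Otimes>\<^sub>M MV) (\<lambda>_. noise_law)"
  unfolding disintegrates_def
proof (intro conjI ballI)
  show "(\<lambda>_. noise_law) \<in> past t \<rightarrow>\<^sub>M prob_algebra (ME \<Otimes>\<^sub>M MV)"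
    using prob_space_noise_law sets_noise_law by (intro measurable_const) (simp add: space_prob_algebra)
  let ?W = "\<lambda>\<omega>. (\<eta> (Suc t) \<omega>, \<epsilon> (Suc t) \<omega>)"
  let ?I = "case_bool (past_sources t) {Eta (Suc t), Eps (Suc t)}"
  let ?S = "\<lambda>k. sigma_sets (space M) (\<Union>i\<in>?I k. source_events i)"
  have "indep_sets ?S UNIV"
  proof (rule indep_sets_collect_sigma)
    show "indep_sets source_events (\<Union>k\<in>UNIV. ?I k)"
      by (rule indep_sets_mono_index[OF _ indep_sources])
         (auto simp: past_sources_def sources_def split: bool.splits)
    show "disjoint_family_on ?I UNIV"
      by (auto simp: disjoint_family_on_def past_sources_def split: bool.splits)
  qed (rule Int_stable_source_events)
  note split = indep_setsD[OF this, of UNIV]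
  fix C D assume C: "C \<in> sets (ME \<Otimes>\<^sub>M MV)" and D: "D \<in> sets (past t)"
  let ?F = "sigma (space M) (\<Union>i\<in>?I False. source_events i)"
  have "(\<Union>i\<in>?I False. source_events i) \<subseteq> Pow (space M)"
    using source_events_subset[of "Eta (Suc t)"] source_events_subset[of "Eps (Suc t)"] sets.sets_into_space
    by (auto simp: sources_def)
  then have F: "sets ?F = ?S False" by (rule sets_measure_of)
  note \<xi> = measurable_noise[of "Suc t", simplified, THEN measurable_space]
  have "\<eta> (Suc t) \<in> ?F \<rightarrow>\<^sub>M ME"
  proof (rule measurableI)
    fix B assume "B \<in> sets ME"
    then have "\<eta> (Suc t) -` B \<inter> space M \<in> ?S False" by (intro sigma_sets.Basic) auto
    then show "\<eta> (Suc t) -` B \<inter> space ?F \<in> sets ?F" unfolding F by (simp only: space_measure_of_conv)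
  qed (simp add: \<xi> space_measure_of_conv)
  moreover have "\<epsilon> (Suc t) \<in> ?F \<rightarrow>\<^sub>M MV"
  proof (rule measurableI)
    fix B assume "B \<in> sets MV"
    then have "\<epsilon> (Suc t) -` B \<inter> space M \<in> ?S False" by (intro sigma_sets.Basic) auto
    then show "\<epsilon> (Suc t) -` B \<inter> space ?F \<in> sets ?F" unfolding F by (simp only: space_measure_of_conv)
  qed (simp add: \<xi> space_measure_of_conv)
  ultimately have "?W \<in> ?F \<rightarrow>\<^sub>M ME \<Otimes>\<^sub>M MV" by (rule measurable_Pair)
  from measurable_sets[OF this C] have WC: "?W -` C \<inter> space M \<in> ?S False"
    unfolding F by (simp only: space_measure_of_conv)
  have D': "D \<in> ?S True" "D \<subseteq> space M"
    using D sets.sets_into_space[OF D] by (simp_all add: sets_past)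
  have "emeasure M (?W -` C \<inter> D) = emeasure M (D \<inter> (?W -` C \<inter> space M))"
    using D'(2) by (intro arg_cong[where f="emeasure M"]) auto
  also have "\<dots> = emeasure M D * emeasure M (?W -` C \<inter> space M)"
  proof -
    have "prob (D \<inter> (?W -` C \<inter> space M)) = prob D * prob (?W -` C \<inter> space M)"
      using split[of "case_bool D (?W -` C \<inter> space M)"] D'(1) WC
      by (simp add: UNIV_bool ac_simps)
    then show ?thesis by (simp add: emeasure_eq_measure ennreal_mult)
  qed
  also have "emeasure M (?W -` C \<inter> space M) = emeasure noise_law C"
    by (simp add: emeasure_distr[OF measurable_next_noise C, symmetric] distr_next_noise)
  also have "emeasure M D * emeasure noise_law C = (\<integral>\<^sup>+ \<omega>\<in>D. emeasure noise_law C \<partial>M)"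
    using D subalgebra_past[of t] by (subst nn_integral_cmult_indicator) (auto simp: subalgebra_def mult.commute)
  finally show "emeasure M (?W -` C \<inter> D) = (\<integral>\<^sup>+ \<omega>\<in>D. emeasure noise_law C \<partial>M)" .
qed

section \<open>States, observations and controls are functions of the past sources\<close>

lemma measurable_Obs: "j \<in> {1..r + 1} \<Longrightarrow> Obs j \<in> sets MX"
proof -
  have *: "Obs j \<in> sets MX" if j: "j \<in> {1..r}" for j
  proof -
    have "J j \<subseteq> {1..m}" using index_sets_J(1)[OF j] by blast
    then have "(\<Union>i\<in>J j. A i) \<in> sets MX"
      using partition_A(1) by (intro sets.finite_UN) (auto intro: finite_subset)
    then show ?thesis using classes_Obs(1)[OF j] by simp
  qed
  assume "j \<in> {1..r + 1}"
  then consider "j \<in> {1..r}" | "j = r + 1" by force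
  then show ?thesis
    by cases (use * classes_Obs(2) in \<open>auto intro!: sets.Diff sets.finite_UN\<close>)
qed

lemma observation_range:
  assumes "\<omega> \<in> space M" "X s \<omega> \<in> space MX"
  shows "Y s \<omega> \<in> {1..r + 1}" "X s \<omega> \<in> Obs (Y s \<omega>)"
proof -
  obtain j where j: "j \<in> {1..r + 1}" "X s \<omega> \<in> Obs j"
  proof (cases "X s \<omega> \<in> (\<Union>j\<in>{1..r}. Obs j)")
    case True
    then show ?thesis using that by force
  next
    case False
    then show ?thesis using that[of "r + 1"] classes_Obs(2) assms(2) by simp
  qed
  then have "Y s \<omega> = j" using observation[OF assms(1) j(1)] by blast
  with j show "Y s \<omega> \<in> {1..r + 1}" "X s \<omega> \<in> Obs (Y s \<omega>)" by simp_all
qed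

lemma measurable_observation:
  assumes sp: "space F = space M" and X: "X s \<in> F \<rightarrow>\<^sub>M MX"
  shows "Y s \<in> F \<rightarrow>\<^sub>M count_space UNIV"
proof (rule measurableI)
  fix B :: "nat set"
  have "Y s -` B \<inter> space F = (\<Union>j\<in>B \<inter> {1..r + 1}. X s -` Obs j \<inter> space F)"
  proof (intro equalityI subsetI)
    fix \<omega> assume \<omega>: "\<omega> \<in> Y s -` B \<inter> space F"
    then have "\<omega> \<in> space M" "X s \<omega> \<in> space MX" using measurable_space[OF X] by (auto simp: sp)
    from observation_range[OF this] \<omega> show "\<omega> \<in> (\<Union>j\<in>B \<inter> {1..r + 1}. X s -` Obs j \<inter> space F)"
      by blast
  next
    fix \<omega> assume "\<omega> \<in> (\<Union>j\<in>B \<inter> {1..r + 1}. X s -` Obs j \<inter> space F)"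
    then obtain j where "j \<in> B" "j \<in> {1..r + 1}" "X s \<omega> \<in> Obs j" "\<omega> \<in> space F" by blast
    then show "\<omega> \<in> Y s -` B \<inter> space F" using observation[of \<omega> j s] by (simp add: sp)
  qed
  moreover have "\<dots> \<in> sets F"
    using measurable_Obs by (intro sets.finite_UN measurable_sets[OF X]) auto
  ultimately show "Y s -` B \<inter> space F \<in> sets F" by simp
qed simp

lemma space_history [simp]: "space (history M MU Y U t) = space M"
  by (simp add: history_def space_measure_of_conv)

lemma sets_history:
  "sets (history M MU Y U t) = sigma_sets (space M)
     ({Y s -` B \<inter> space M | s B. s \<le> t} \<union> {U s -` B \<inter> space M | s B. s < t \<and> B \<in> sets MU})"
  unfolding history_def by (rule sets_measure_of) auto

lemma measurable_history_observation:
  "s \<le> t \<Longrightarrow> Y s \<in> history M MU Y U t \<rightarrow>\<^sub>M count_space UNIV"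
  by (rule measurableI) (auto simp: sets_history intro!: sigma_sets.Basic)

lemma history_least:
  assumes sp: "space F = space M"
    and Y: "\<And>s. s \<le> t \<Longrightarrow> Y s \<in> F \<rightarrow>\<^sub>M count_space UNIV"
    and U: "\<And>s. s < t \<Longrightarrow> U s \<in> F \<rightarrow>\<^sub>M MU"
  shows "sets (history M MU Y U t) \<subseteq> sets F"
proof -
  have "{Y s -` B \<inter> space M | s B. s \<le> t} \<union> {U s -` B \<inter> space M | s B. s < t \<and> B \<in> sets MU}
      \<subseteq> sets F"
    using measurable_sets[OF Y] measurable_sets[OF U] by (auto simp: sp)
  then show ?thesis
    unfolding sets_history sp[symmetric] by (rule sets.sigma_sets_subset)
qed

lemma history_mono: "s \<le> t \<Longrightarrow> sets (history M MU Y U s) \<subseteq> sets (history M MU Y U t)"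
  unfolding sets_history 
  by (intro sigma_sets_mono' Un_mono) (blast intro: order.trans order.strict_trans2)+

text \<open>
  The two statements need a joint induction: the next state depends on the current control, the
  control on the history, and the history on the observations of earlier states.
\<close>

lemma adapted_past: "X t \<in> past t \<rightarrow>\<^sub>M MX \<and> sets (history M MU Y U t) \<subseteq> sets (past t)"
proof (induction t)
  case 0
  have "X 0 \<in> past 0 \<rightarrow>\<^sub>M MX" by (rule measurable_past_sources)
  moreover from this have "sets (history M MU Y U 0) \<subseteq> sets (past 0)"
    by (intro history_least) (simp_all add: measurable_observation)
  ultimately show ?case ..
next
  case (Suc t)
  have lift: "f \<in> past (Suc t) \<rightarrow>\<^sub>M N" if "f \<in> past t \<rightarrow>\<^sub>M N" for f :: "'w \<Rightarrow> 'n" and N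
    using that past_mono[of t "Suc t"] by (auto intro: measurable_mono_space)
  have hist: "sets (history M MU Y U t) \<subseteq> sets (past (Suc t))"
    using Suc past_mono[of t "Suc t"] by auto
  have Upast: "U s \<in> past (Suc t) \<rightarrow>\<^sub>M MU" if "s \<le> t" for s
    using measurable_mono_space[OF admissible order_trans[OF history_mono[OF that] hist]] by simp
  have Xt: "X t \<in> past (Suc t) \<rightarrow>\<^sub>M MX" using Suc lift by blast
  have "(\<lambda>\<omega>. G (X t \<omega>, U t \<omega>, \<eta> (Suc t) \<omega>, \<epsilon> (Suc t) \<omega>)) \<in> past (Suc t) \<rightarrow>\<^sub>M MX"
    using Xt Upast[of t] measurable_past_sources(2,3)[of "Suc t" "Suc t"]
    by (intro measurable_compose[OF _ measurable_G] measurable_Pair) auto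
  then have XS: "X (Suc t) \<in> past (Suc t) \<rightarrow>\<^sub>M MX"
    by (rule measurable_cong[THEN iffD1, rotated]) (simp add: dynamics)
  have "Y s \<in> past (Suc t) \<rightarrow>\<^sub>M count_space UNIV" if "s \<le> Suc t" for s
  proof (cases "s = Suc t")
    case True
    then show ?thesis using XS by (auto intro: measurable_observation)
  next
    case False
    then have "s \<le> t" using that by simp
    then show ?thesis
      using measurable_mono_space[OF measurable_history_observation hist] by simp
  qed
  then have "sets (history M MU Y U (Suc t)) \<subseteq> sets (past (Suc t))"
    using Upast by (intro history_least) auto
  with XS show ?case ..
qed

lemma measurable_past_state: "X t \<in> past t \<rightarrow>\<^sub>M MX"
  and history_subset_past: "sets (history M MU Y U t) \<subseteq> sets (past t)"
  using adapted_past by auto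

lemma measurable_past_control: "U t \<in> past t \<rightarrow>\<^sub>M MU"
  using measurable_mono_space[OF admissible history_subset_past] by simp

lemma measurable_state: "X t \<in> M \<rightarrow>\<^sub>M MX"
  using measurable_past_state by (rule measurable_from_subalg[OF subalgebra_past])

lemma subalgebra_history: "subalgebra M (history M MU Y U t)"
  using subalgebra_past[of t] history_subset_past[of t] by (auto simp: subalgebra_def)

section \<open>The controlled kernel and the prediction operator\<close>

text \<open>
  Writing the iterated integral against the law of the noise pair lets a single disintegration
  integrate out both noises.
\<close>

lemma controlled_kernel_eq_noise_law:
  assumes C[measurable]: "C \<in> sets MX" and x: "x \<in> space MX" and u: "u \<in> space MU"
  shows "controlled_kernel G \<nu>\<eta> \<nu>\<epsilon> C x u = (\<integral>\<^sup>+ w. indicator C (G (x, u, w)) \<partial>noise_law)"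
proof -
  interpret E: prob_space \<nu>\<epsilon> by (rule prob_space_noises)
  note [measurable] = measurable_G
  have "(\<lambda>w. indicator C (G (x, u, w)) :: ennreal) \<in> borel_measurable (\<nu>\<eta> \<Otimes>\<^sub>M \<nu>\<epsilon>)"
    using x u by measurable
  from E.nn_integral_fst[OF this] show ?thesis
    by (simp add: controlled_kernel_def noise_law_def)
qed

lemma measurable_controlled_kernel:
  assumes C[measurable]: "C \<in> sets MX"
  shows "(\<lambda>(x, u). controlled_kernel G \<nu>\<eta> \<nu>\<epsilon> C x u) \<in> borel_measurable (MX \<Otimes>\<^sub>M MU)"
proof -
  interpret W: prob_space noise_law by (rule prob_space_noise_law)
  note [measurable] = measurable_G
  have "(\<lambda>p. \<integral>\<^sup>+ w. indicator C (G (fst p, snd p, w)) \<partial>noise_law) \<in> borel_measurable (MX \<Otimes>\<^sub>M MU)"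
    by measurable
  then show ?thesis
    by (rule measurable_cong[THEN iffD1, rotated])
       (auto simp: space_pair_measure controlled_kernel_eq_noise_law)
qed

lemma controlled_kernel_space:
  assumes "x \<in> space MX" "u \<in> space MU"
  shows "controlled_kernel G \<nu>\<eta> \<nu>\<epsilon> (space MX) x u = 1"
proof -
  interpret W: prob_space noise_law by (rule prob_space_noise_law)
  have "controlled_kernel G \<nu>\<eta> \<nu>\<epsilon> (space MX) x u = (\<integral>\<^sup>+ w. 1 \<partial>noise_law)"
    unfolding controlled_kernel_eq_noise_law[OF sets.top assms]
    using assms sets_eq_imp_space_eq[OF sets_noise_law] measurable_space[OF measurable_G]
    by (intro nn_integral_cong) (auto simp: space_pair_measure indicator_def)
  then show ?thesis by (simp add: W.emeasure_space_1)
qed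

abbreviation "prediction \<equiv> predict MX G \<nu>\<eta> \<nu>\<epsilon>"

lemma emeasure_prediction:
  assumes "\<mu> \<in> space (prob_algebra MX)" "u \<in> space MU" "C \<in> sets MX"
  shows "emeasure (prediction u \<mu>) C = (\<integral>\<^sup>+ x. controlled_kernel G \<nu>\<eta> \<nu>\<epsilon> C x u \<partial>\<mu>)"
  by (rule emeasure_predict[OF measurable_G noise_laws assms])

lemma sets_prediction [simp]: "sets (prediction u \<mu>) = sets MX"
  and space_prediction [simp]: "space (prediction u \<mu>) = space MX"
  by (simp_all add: predict_def sets.sigma_sets_eq space_measure_of_conv)

lemma prob_space_prediction:
  assumes "\<mu> \<in> space (prob_algebra MX)" "u \<in> space MU"
  shows "prob_space (prediction u \<mu>)"
proof
  interpret P: prob_space \<mu> using assms by (simp add: space_prob_algebra)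
  have "space \<mu> = space MX" using assms by (auto simp: space_prob_algebra dest: sets_eq_imp_space_eq)
  then have "(\<integral>\<^sup>+ x. controlled_kernel G \<nu>\<eta> \<nu>\<epsilon> (space MX) x u \<partial>\<mu>) = (\<integral>\<^sup>+ x. 1 \<partial>\<mu>)"
    using assms(2) by (intro nn_integral_cong) (simp add: controlled_kernel_space)
  then show "emeasure (prediction u \<mu>) (space (prediction u \<mu>)) = 1"
    using emeasure_prediction[OF assms sets.top] by (simp add: P.emeasure_space_1)
qed

lemma measurable_prediction:
  assumes \<kappa>: "\<kappa> \<in> F \<rightarrow>\<^sub>M prob_algebra MX" and u[measurable]: "u \<in> F \<rightarrow>\<^sub>M MU"
  shows "(\<lambda>\<omega>. prediction (u \<omega>) (\<kappa> \<omega>)) \<in> F \<rightarrow>\<^sub>M prob_algebra MX"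
proof (rule measurable_prob_algebraI)
  note val = measurable_space[OF \<kappa>] measurable_space[OF u]
  show prob: "prob_space (prediction (u \<omega>) (\<kappa> \<omega>))" if "\<omega> \<in> space F" for \<omega>
    using val[OF that] by (rule prob_space_prediction)
  show "(\<lambda>\<omega>. prediction (u \<omega>) (\<kappa> \<omega>)) \<in> F \<rightarrow>\<^sub>M subprob_algebra MX"
  proof (rule measurable_subprob_algebra)
    show "subprob_space (prediction (u \<omega>) (\<kappa> \<omega>))" if "\<omega> \<in> space F" for \<omega>
      using prob[OF that] by (rule prob_space_imp_subprob_space)
    fix C assume C: "C \<in> sets MX"
    have swap: "(\<lambda>p. (snd p, u (fst p))) \<in> F \<Otimes>\<^sub>M MX \<rightarrow>\<^sub>M MX \<Otimes>\<^sub>M MU" by measurable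
    have "(\<lambda>(\<omega>, x). controlled_kernel G \<nu>\<eta> \<nu>\<epsilon> C x (u \<omega>)) \<in> borel_measurable (F \<Otimes>\<^sub>M MX)"
      using measurable_compose[OF swap measurable_controlled_kernel[OF C]]
      by (simp add: case_prod_beta)
    then have "(\<lambda>\<omega>. \<integral>\<^sup>+ x. controlled_kernel G \<nu>\<eta> \<nu>\<epsilon> C x (u \<omega>) \<partial>\<kappa> \<omega>) \<in> borel_measurable F"
      by (rule nn_integral_measurable_subprob_algebra2) (rule measurable_prob_algebraD[OF \<kappa>])
    then show "(\<lambda>\<omega>. emeasure (prediction (u \<omega>) (\<kappa> \<omega>)) C) \<in> borel_measurable F"
      by (rule measurable_cong[THEN iffD1, rotated]) (simp add: emeasure_prediction val C)
  qed simp
qed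

section \<open>Prediction step\<close>

text \<open>
  Two disintegrations in a row: first the next noise pair given the past, which produces the
  controlled kernel at \<open>(X t, U t)\<close>, then \<open>X t\<close> given the history. The first one is legitimate
  because events of the history belong to the past.
\<close>

lemma disintegrates_prediction:
  assumes dis: "disintegrates M (history M MU Y U t) (X t) MX \<kappa>"
  shows "disintegrates M (history M MU Y U t) (X (Suc t)) MX (\<lambda>\<omega>. prediction (U t \<omega>) (\<kappa> \<omega>))"
  unfolding disintegrates_def
proof (intro conjI ballI)
  let ?H = "history M MU Y U t"
  note \<kappa> = disintegratesD(1)[OF dis]
  note val = measurable_space[OF \<kappa>, simplified] measurable_space[OF admissible[of t], simplified]
  note Xval = measurable_space[OF measurable_state]
  show "(\<lambda>\<omega>. prediction (U t \<omega>) (\<kappa> \<omega>)) \<in> ?H \<rightarrow>\<^sub>M prob_algebra MX"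
    by (rule measurable_prediction[OF \<kappa> admissible])
  fix C D assume C[measurable]: "C \<in> sets MX" and D: "D \<in> sets ?H"
  have DP: "D \<in> sets (past t)" using D history_subset_past by blast
  have DM: "D \<in> sets M" using D subalgebra_history by (auto simp: subalgebra_def)
  let ?W = "\<lambda>\<omega>. (\<eta> (Suc t) \<omega>, \<epsilon> (Suc t) \<omega>)"
  note [measurable] = measurable_G
  have "X (Suc t) -` C \<inter> D \<in> sets M"
    using measurable_sets[OF measurable_state C, of "Suc t"] DM sets.sets_into_space[OF DM]
    by (metis inf.absorb_iff2 inf.assoc sets.Int)
  then have "emeasure M (X (Suc t) -` C \<inter> D) = (\<integral>\<^sup>+ \<omega>. indicator (X (Suc t) -` C \<inter> D) \<omega> \<partial>M)"
    by simp
  also have "\<dots> = (\<integral>\<^sup>+ \<omega>. indicator C (G (X t \<omega>, U t \<omega>, ?W \<omega>)) * indicator D \<omega> \<partial>M)"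
    by (intro nn_integral_cong) (auto simp: dynamics indicator_def)
  also have "\<dots> = (\<integral>\<^sup>+ \<omega>. \<integral>\<^sup>+ w. indicator C (G (X t \<omega>, U t \<omega>, w)) * indicator D \<omega> \<partial>noise_law \<partial>M)"
  proof (rule nn_integral_disintegrates[OF subalgebra_past measurable_next_noise disintegrates_next_noise])
    note [measurable] = measurable_past_state[of t] measurable_past_control[of t] DP
    show "(\<lambda>(w, \<omega>). indicator C (G (X t \<omega>, U t \<omega>, w)) * indicator D \<omega> :: ennreal)
        \<in> borel_measurable ((ME \<Otimes>\<^sub>M MV) \<Otimes>\<^sub>M past t)"
      by measurable
  qed
  also have "\<dots> = (\<integral>\<^sup>+ \<omega>. controlled_kernel G \<nu>\<eta> \<nu>\<epsilon> C (X t \<omega>) (U t \<omega>) * indicator D \<omega> \<partial>M)"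
    by (intro nn_integral_cong)
       (auto simp: indicator_def controlled_kernel_eq_noise_law[OF C Xval val(2)])
  also have "\<dots> = (\<integral>\<^sup>+ \<omega>. \<integral>\<^sup>+ x. controlled_kernel G \<nu>\<eta> \<nu>\<epsilon> C x (U t \<omega>) * indicator D \<omega> \<partial>\<kappa> \<omega> \<partial>M)"
  proof (rule nn_integral_disintegrates[OF subalgebra_history measurable_state dis])
    note [measurable] = admissible[of t] D
    have "(\<lambda>p. (fst p, U t (snd p))) \<in> MX \<Otimes>\<^sub>M ?H \<rightarrow>\<^sub>M MX \<Otimes>\<^sub>M MU" by measurable
    from measurable_compose[OF this measurable_controlled_kernel[OF C]]
    have [measurable]: "(\<lambda>p. controlled_kernel G \<nu>\<eta> \<nu>\<epsilon> C (fst p) (U t (snd p)))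
        \<in> borel_measurable (MX \<Otimes>\<^sub>M ?H)" by simp
    show "(\<lambda>(x, \<omega>). controlled_kernel G \<nu>\<eta> \<nu>\<epsilon> C x (U t \<omega>) * indicator D \<omega>)
        \<in> borel_measurable (MX \<Otimes>\<^sub>M ?H)"
      unfolding case_prod_beta by measurable
  qed
  also have "\<dots> = (\<integral>\<^sup>+ \<omega>\<in>D. emeasure (prediction (U t \<omega>) (\<kappa> \<omega>)) C \<partial>M)"
    by (intro nn_integral_cong) (auto simp: indicator_def emeasure_prediction[OF val C])
  finally show "emeasure M (X (Suc t) -` C \<inter> D)
      = (\<integral>\<^sup>+ \<omega>\<in>D. emeasure (prediction (U t \<omega>) (\<kappa> \<omega>)) C \<partial>M)" .
qed

section \<open>Correction step\<close>

abbreviation "update \<rho> j \<mu> u \<equiv> filter_update MX G \<nu>\<eta> \<nu>\<epsilon> Obs \<rho> j \<mu> u"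

lemma obs_prob_eq_emeasure:
  assumes "\<mu> \<in> space (prob_algebra MX)" "u \<in> space MU"
  shows "ennreal (obs_prob MX G \<nu>\<eta> \<nu>\<epsilon> Obs j \<mu> u) = emeasure (prediction u \<mu>) (Obs j)"
proof -
  interpret P: prob_space "prediction u \<mu>" using assms by (rule prob_space_prediction)
  show ?thesis by (simp add: obs_prob_def P.emeasure_eq_measure)
qed

text \<open>
  Bayes' rule multiplied by its denominator. This form also holds when the class is unreachable,
  so reachable and unreachable branches can be integrated together.
\<close>

lemma emeasure_update_times_prediction:
  assumes "\<mu> \<in> space (prob_algebra MX)" "u \<in> space MU" "j \<in> {1..r + 1}" "C \<in> sets MX"
  shows "emeasure (update \<rho> j \<mu> u) C * emeasure (prediction u \<mu>) (Obs j)
       = emeasure (prediction u \<mu>) (C \<inter> Obs j)"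
proof -
  interpret P: prob_space "prediction u \<mu>" using assms(1,2) by (rule prob_space_prediction)
  have Oj: "Obs j \<in> sets MX" using assms(3) by (rule measurable_Obs)
  note q = obs_prob_eq_emeasure[OF assms(1,2), of j]
  show ?thesis
  proof (cases "obs_prob MX G \<nu>\<eta> \<nu>\<epsilon> Obs j \<mu> u > 0")
    case True
    then have "emeasure (prediction u \<mu>) (Obs j) \<noteq> 0" using q by (auto simp: ennreal_eq_0_iff)
    moreover have "emeasure (prediction u \<mu>) (Obs j) \<noteq> top" by simp
    moreover have "emeasure (update \<rho> j \<mu> u) C
        = 1 / emeasure (prediction u \<mu>) (Obs j) * emeasure (prediction u \<mu>) (C \<inter> Obs j)"
      using True by (simp add: filter_update_def q emeasure_restricted_predict[of Obs j MX, OF Oj assms(4)])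
    ultimately show ?thesis
      by (simp add: ennreal_divide_times ennreal_divide_self less_top[symmetric])
  next
    case False
    then have "obs_prob MX G \<nu>\<eta> \<nu>\<epsilon> Obs j \<mu> u = 0"
      using measure_nonneg[of "prediction u \<mu>" "Obs j"] by (simp add: obs_prob_def)
    then have "emeasure (prediction u \<mu>) (Obs j) = 0" using q by simp
    moreover from this have "emeasure (prediction u \<mu>) (C \<inter> Obs j) = 0"
      using emeasure_mono[of "C \<inter> Obs j" "Obs j" "prediction u \<mu>"] Oj by simp
    ultimately show ?thesis by simp
  qed
qed

lemma update_in_prob_algebra:
  assumes "\<mu> \<in> space (prob_algebra MX)" "u \<in> space MU" "j \<in> {1..r + 1}"
    and \<rho>: "\<rho> j \<in> space (prob_algebra MX)"
  shows "update \<rho> j \<mu> u \<in> space (prob_algebra MX)"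
proof (cases "obs_prob MX G \<nu>\<eta> \<nu>\<epsilon> Obs j \<mu> u > 0")
  case True
  interpret P: prob_space "prediction u \<mu>" using assms(1,2) by (rule prob_space_prediction)
  note q = obs_prob_eq_emeasure[OF assms(1,2), of j]
  have sets: "sets (update \<rho> j \<mu> u) = sets MX"
    using True by (simp add: filter_update_def restricted_predict_def sets.sigma_sets_eq)
  have "emeasure (prediction u \<mu>) (space MX \<inter> Obs j) = emeasure (prediction u \<mu>) (Obs j)"
    using sets.sets_into_space[OF measurable_Obs[OF assms(3)]] by (simp add: Int_absorb1)
  then have "emeasure (update \<rho> j \<mu> u) (space MX) * emeasure (prediction u \<mu>) (Obs j)
      = emeasure (prediction u \<mu>) (Obs j)"
    using emeasure_update_times_prediction[OF assms(1-3) sets.top] by simp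
  moreover have "emeasure (prediction u \<mu>) (Obs j) \<noteq> 0" using True q by (auto simp: ennreal_eq_0_iff)
  moreover have "emeasure (prediction u \<mu>) (Obs j) \<noteq> top" by simp
  ultimately have "emeasure (update \<rho> j \<mu> u) (space MX) = 1"
    by (metis ennreal_divide_self less_top mult_divide_eq_ennreal)
  then have "prob_space (update \<rho> j \<mu> u)"
    using sets_eq_imp_space_eq[OF sets] by (intro prob_spaceI) simp
  then show ?thesis using sets by (simp add: space_prob_algebra)
next
  case False
  then show ?thesis using \<rho> by (simp add: filter_update_def)
qed

lemma measurable_update:
  assumes \<kappa>: "\<kappa> \<in> F \<rightarrow>\<^sub>M prob_algebra MX" and u: "u \<in> F \<rightarrow>\<^sub>M MU"
    and j: "j \<in> {1..r + 1}" and \<rho>: "\<rho> j \<in> space (prob_algebra MX)"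
  shows "(\<lambda>\<omega>. update \<rho> j (\<kappa> \<omega>) (u \<omega>)) \<in> F \<rightarrow>\<^sub>M prob_algebra MX"
proof (rule measurable_prob_algebraI)
  have val: "update \<rho> j (\<kappa> \<omega>) (u \<omega>) \<in> space (prob_algebra MX)" if "\<omega> \<in> space F" for \<omega>
    using measurable_space[OF \<kappa> that] measurable_space[OF u that] j \<rho>
    by (rule update_in_prob_algebra)
  show "prob_space (update \<rho> j (\<kappa> \<omega>) (u \<omega>))" if "\<omega> \<in> space F" for \<omega>
    using val[OF that] by (simp add: space_prob_algebra)
  show "(\<lambda>\<omega>. update \<rho> j (\<kappa> \<omega>) (u \<omega>)) \<in> F \<rightarrow>\<^sub>M subprob_algebra MX"
  proof (rule measurable_subprob_algebra)
    show "subprob_space (update \<rho> j (\<kappa> \<omega>) (u \<omega>))" if "\<omega> \<in> space F" for \<omega>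
      using val[OF that] by (simp add: space_prob_algebra prob_space_imp_subprob_space)
    show "sets (update \<rho> j (\<kappa> \<omega>) (u \<omega>)) = sets MX" if "\<omega> \<in> space F" for \<omega>
      using val[OF that] by (simp add: space_prob_algebra)
    fix C assume C: "C \<in> sets MX"
    note K = measurable_prediction[OF \<kappa> u]
    have Oj: "Obs j \<in> sets MX" using j by (rule measurable_Obs)
    have p[measurable]: "(\<lambda>\<omega>. obs_prob MX G \<nu>\<eta> \<nu>\<epsilon> Obs j (\<kappa> \<omega>) (u \<omega>)) \<in> borel_measurable F"
      unfolding obs_prob_def using measurable_compose[OF K measurable_measure_prob_algebra[OF Oj]] .
    have e[measurable]: "(\<lambda>\<omega>. emeasure (prediction (u \<omega>) (\<kappa> \<omega>)) (C \<inter> Obs j)) \<in> borel_measurable F"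
      using C Oj by (intro borel_measurable_emeasure_kernel[OF K]) auto
    have eq: "emeasure (update \<rho> j (\<kappa> \<omega>) (u \<omega>)) C =
        (if obs_prob MX G \<nu>\<eta> \<nu>\<epsilon> Obs j (\<kappa> \<omega>) (u \<omega>) > 0
         then 1 / ennreal (obs_prob MX G \<nu>\<eta> \<nu>\<epsilon> Obs j (\<kappa> \<omega>) (u \<omega>))
                * emeasure (prediction (u \<omega>) (\<kappa> \<omega>)) (C \<inter> Obs j)
         else emeasure (\<rho> j) C)" for \<omega>
      by (simp add: filter_update_def emeasure_restricted_predict[of Obs j MX, OF Oj C])
    show "(\<lambda>\<omega>. emeasure (update \<rho> j (\<kappa> \<omega>) (u \<omega>)) C) \<in> borel_measurable F"
      unfolding eq by measurable
  qed
qed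

text \<open>
  The events with the stated property form a \<open>\<sigma>\<close>-algebra. It contains the generators of the new
  history: those that involve \<open>Y (Suc t)\<close> become trivial on \<open>Y (Suc t) = j\<close>, and \<open>U t\<close> was already
  measurable for the old history by admissibility.
\<close>

lemma history_trace_on_observation:
  assumes "D \<in> sets (history M MU Y U (Suc t))"
  shows "\<exists>D'\<in>sets (history M MU Y U t).
           D \<inter> Y (Suc t) -` {j} = D' \<inter> Y (Suc t) -` {j}"
  using assms unfolding sets_history[of "Suc t"]
proof (induction rule: sigma_sets.induct)
  case (Basic a)
  let ?H = "history M MU Y U t"
  from Basic consider
      (observed) s B where "s \<le> Suc t" "a = Y s -` B \<inter> space M"
    | (control) s B where "s < Suc t" "B \<in> sets MU" "a = U s -` B \<inter> space M"
    by blast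
  then show ?case
  proof cases
    case observed
    consider "s \<le> t" | "s = Suc t" "j \<in> B" | "s = Suc t" "j \<notin> B"
      using observed(1) by linarith
    then show ?thesis
    proof cases
      case 1
      from measurable_sets[OF measurable_history_observation[OF this], of B]
      have "a \<in> sets ?H" by (simp add: observed(2))
      then show ?thesis by blast
    next
      case 2
      then have "a \<inter> Y (Suc t) -` {j} = space M \<inter> Y (Suc t) -` {j}" using observed(2) by blast
      then show ?thesis using sets.top[of ?H] unfolding space_history by blast
    next
      case 3
      then have "a \<inter> Y (Suc t) -` {j} = {} \<inter> Y (Suc t) -` {j}" using observed(2) by blast
      then show ?thesis using sets.empty_sets[of ?H] by blast
    qed
  next
    case control
    have "U s \<in> ?H \<rightarrow>\<^sub>M MU"
      using measurable_mono_space[OF admissible history_mono] control(1) by simp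
    from measurable_sets[OF this control(2)] have "a \<in> sets ?H" by (simp add: control(3))
    then show ?thesis by blast
  qed
next
  case Empty
  then show ?case by (intro bexI[of _ "{}"]) auto
next
  case (Compl a)
  then obtain D' where "D' \<in> sets (history M MU Y U t)"
      "a \<inter> Y (Suc t) -` {j} = D' \<inter> Y (Suc t) -` {j}" by blast
  then show ?case
    using sets.compl_sets[of D' "history M MU Y U t"] by (intro bexI[of _ "space M - D'"]) auto
next
  case (Union a)
  then have "\<forall>i. \<exists>D'. D' \<in> sets (history M MU Y U t) \<and>
      a i \<inter> Y (Suc t) -` {j} = D' \<inter> Y (Suc t) -` {j}" by blast
  then obtain D' where D': "\<And>i. D' i \<in> sets (history M MU Y U t)"
      "\<And>i. a i \<inter> Y (Suc t) -` {j} = D' i \<inter> Y (Suc t) -` {j}" by metis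
  have "(\<Union>i. a i) \<inter> Y (Suc t) -` {j} = (\<Union>i. a i \<inter> Y (Suc t) -` {j})" by blast
  also have "\<dots> = (\<Union>i. D' i) \<inter> Y (Suc t) -` {j}" unfolding D'(2) by blast
  finally show ?case using D'(1) by (intro bexI[of _ "\<Union>i. D' i"]) auto
qed

text \<open>
  Empty classes are excluded because the fallback laws are constrained only for nonempty ones.
\<close>

definition possible_observations :: "nat set" where
  "possible_observations = {j \<in> {1..r + 1}. Obs j \<noteq> {}}"

lemma observation_possible:
  "\<omega> \<in> space M \<Longrightarrow> Y s \<omega> \<in> possible_observations"
  using observation_range[of \<omega> s] measurable_space[OF measurable_state, of \<omega> s]
  by (auto simp: possible_observations_def)

lemma finite_possible_observations: "finite possible_observations"
  by (simp add: possible_observations_def)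

lemma observation_iff:
  "\<omega> \<in> space M \<Longrightarrow> j \<in> possible_observations \<Longrightarrow> Y s \<omega> = j \<longleftrightarrow> X s \<omega> \<in> Obs j"
  using observation by (auto simp: possible_observations_def)

lemma nn_integral_split_observation:
  assumes g: "g \<in> borel_measurable M" and D: "D \<in> sets M"
  shows "(\<integral>\<^sup>+ \<omega>\<in>D. g \<omega> \<partial>M) = (\<Sum>j\<in>possible_observations. \<integral>\<^sup>+ \<omega>\<in>D \<inter> Y s -` {j}. g \<omega> \<partial>M)"
proof -
  have Y: "Y s \<in> M \<rightarrow>\<^sub>M count_space UNIV"
    using measurable_observation[OF refl measurable_state] .
  have DY: "D \<inter> Y s -` {j} \<in> sets M" for j
  proof -
    have "D \<inter> Y s -` {j} = D \<inter> (Y s -` {j} \<inter> space M)" using sets.sets_into_space[OF D] by auto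
    then show ?thesis using D measurable_sets[OF Y, of "{j}"] by simp
  qed
  have "(\<integral>\<^sup>+ \<omega>\<in>D. g \<omega> \<partial>M)
      = (\<integral>\<^sup>+ \<omega>. (\<Sum>j\<in>possible_observations. g \<omega> * indicator (D \<inter> Y s -` {j}) \<omega>) \<partial>M)"
  proof (rule nn_integral_cong)
    fix \<omega> assume "\<omega> \<in> space M"
    have "(\<Sum>j\<in>possible_observations. g \<omega> * indicator (D \<inter> Y s -` {j}) \<omega>)
        = (\<Sum>j\<in>possible_observations. if j = Y s \<omega> then g \<omega> * indicator D \<omega> else 0)"
      by (intro sum.cong) (auto simp: indicator_def)
    then show "g \<omega> * indicator D \<omega>
        = (\<Sum>j\<in>possible_observations. g \<omega> * indicator (D \<inter> Y s -` {j}) \<omega>)"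
      using observation_possible[OF \<open>\<omega> \<in> space M\<close>, of s] finite_possible_observations
      by (simp add: sum.delta)
  qed
  also have "\<dots> = (\<Sum>j\<in>possible_observations. \<integral>\<^sup>+ \<omega>\<in>D \<inter> Y s -` {j}. g \<omega> \<partial>M)"
    using g DY by (intro nn_integral_sum borel_measurable_times_ennreal borel_measurable_indicator) auto
  finally show ?thesis .
qed

text \<open>
  Split an event of the new history according to the next observation. On each piece it may be
  replaced by an event \<open>D'\<close> of the old history, and the update along the fixed branch \<open>j\<close> is
  measurable for the old history as well. Disintegrating \<open>X (Suc t)\<close> by the predicted law then
  replaces the indicator of \<open>Obs j\<close> by its predicted probability, and the product form of Bayes'
  rule closes the computation.
\<close>

lemma disintegrates_update:
  assumes dis: "disintegrates M (history M MU Y U t) (X t) MX \<kappa>"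
    and \<rho>: "\<And>j. j \<in> possible_observations \<Longrightarrow> \<rho> j \<in> space (prob_algebra MX)"
  shows "disintegrates M (history M MU Y U (Suc t)) (X (Suc t)) MX
           (\<lambda>\<omega>. update \<rho> (Y (Suc t) \<omega>) (\<kappa> \<omega>) (U t \<omega>))"
  unfolding disintegrates_def
proof (intro conjI ballI)
  let ?H = "history M MU Y U t" and ?H' = "history M MU Y U (Suc t)"
  let ?new = "\<lambda>\<omega>. update \<rho> (Y (Suc t) \<omega>) (\<kappa> \<omega>) (U t \<omega>)"
  note \<kappa> = disintegratesD(1)[OF dis]
  note val = measurable_space[OF \<kappa>, simplified] measurable_space[OF admissible[of t], simplified]
  have upd: "(\<lambda>\<omega>. update \<rho> j (\<kappa> \<omega>) (U t \<omega>)) \<in> ?H \<rightarrow>\<^sub>M prob_algebra MX"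
    if "j \<in> possible_observations" for j
    using that \<rho>[OF that] by (intro measurable_update[OF \<kappa> admissible]) (auto simp: possible_observations_def)
  show new: "?new \<in> ?H' \<rightarrow>\<^sub>M prob_algebra MX"
  proof (rule measurable_compose_countable'[where I = possible_observations
        and g = "Y (Suc t)" and f = "\<lambda>j \<omega>. update \<rho> j (\<kappa> \<omega>) (U t \<omega>)"])
    show "(\<lambda>\<omega>. update \<rho> j (\<kappa> \<omega>) (U t \<omega>)) \<in> ?H' \<rightarrow>\<^sub>M prob_algebra MX"
      if "j \<in> possible_observations" for j
      using measurable_mono_space[OF upd[OF that] history_mono[of t "Suc t"]] by simp
    show "Y (Suc t) \<in> ?H' \<rightarrow>\<^sub>M count_space possible_observations"
      using observation_possible
      by (intro measurable_count_space_extend[OF subset_UNIV _ measurable_history_observation]) auto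
  qed (simp add: finite_possible_observations countable_finite)
  fix C D assume C: "C \<in> sets MX" and D: "D \<in> sets ?H'"
  have DM: "D \<in> sets M" using D subalgebra_history by (auto simp: subalgebra_def)
  have HM: "\<And>D'. D' \<in> sets ?H \<Longrightarrow> D' \<in> sets M" using subalgebra_history by (auto simp: subalgebra_def)
  \<comment> \<open>Both sides of the goal are integrals over \<open>D\<close>, so they can be compared on each observation separately.\<close>
  have branch: "(\<integral>\<^sup>+ \<omega>\<in>D \<inter> Y (Suc t) -` {j}. indicator (X (Suc t) -` C \<inter> space M) \<omega> \<partial>M)
      = (\<integral>\<^sup>+ \<omega>\<in>D \<inter> Y (Suc t) -` {j}. emeasure (?new \<omega>) C \<partial>M)"
    if j: "j \<in> possible_observations" for j
  proof -
    have jr: "j \<in> {1..r + 1}" using j by (simp add: possible_observations_def)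
    have Oj: "Obs j \<in> sets MX" using jr by (rule measurable_Obs)
    obtain D' where D': "D' \<in> sets ?H" and trace: "D \<inter> Y (Suc t) -` {j} = D' \<inter> Y (Suc t) -` {j}"
      using history_trace_on_observation[OF D] by blast
    \<comment> \<open>The new observation is absorbed into a condition on the state.\<close>
    have cell: "indicator (D \<inter> Y (Suc t) -` {j}) \<omega> = (indicator (Obs j) (X (Suc t) \<omega>) * indicator D' \<omega> :: ennreal)"
      if "\<omega> \<in> space M" for \<omega>
      unfolding trace using observation_iff[OF that j, of "Suc t"] by (auto simp: indicator_def)
    have "(\<integral>\<^sup>+ \<omega>\<in>D \<inter> Y (Suc t) -` {j}. indicator (X (Suc t) -` C \<inter> space M) \<omega> \<partial>M)
        = (\<integral>\<^sup>+ \<omega>. indicator (X (Suc t) -` (C \<inter> Obs j) \<inter> D') \<omega> \<partial>M)"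
      by (rule nn_integral_cong, subst cell) (auto simp: indicator_def)
    also have "\<dots> = emeasure M (X (Suc t) -` (C \<inter> Obs j) \<inter> D')"
    proof (rule nn_integral_indicator)
      have "X (Suc t) -` (C \<inter> Obs j) \<inter> D' = (X (Suc t) -` (C \<inter> Obs j) \<inter> space M) \<inter> D'"
        using sets.sets_into_space[OF HM[OF D']] by auto
      then show "X (Suc t) -` (C \<inter> Obs j) \<inter> D' \<in> sets M"
        using measurable_sets[OF measurable_state, of "C \<inter> Obs j"] HM[OF D'] C Oj by auto
    qed
    also have "\<dots> = (\<integral>\<^sup>+ \<omega>\<in>D'. emeasure (prediction (U t \<omega>) (\<kappa> \<omega>)) (C \<inter> Obs j) \<partial>M)"
      using C Oj D' by (intro disintegratesD(2)[OF disintegrates_prediction[OF dis]]) auto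
    also have "\<dots> = (\<integral>\<^sup>+ \<omega>. \<integral>\<^sup>+ x. indicator (Obs j) x *
          (emeasure (update \<rho> j (\<kappa> \<omega>) (U t \<omega>)) C * indicator D' \<omega>) \<partial>prediction (U t \<omega>) (\<kappa> \<omega>) \<partial>M)"
    proof (rule nn_integral_cong)
      fix \<omega> assume \<omega>: "\<omega> \<in> space M"
      show "emeasure (prediction (U t \<omega>) (\<kappa> \<omega>)) (C \<inter> Obs j) * indicator D' \<omega>
          = (\<integral>\<^sup>+ x. indicator (Obs j) x *
              (emeasure (update \<rho> j (\<kappa> \<omega>) (U t \<omega>)) C * indicator D' \<omega>) \<partial>prediction (U t \<omega>) (\<kappa> \<omega>))"
        using Oj emeasure_update_times_prediction[OF val[OF \<omega>] jr C, of \<rho>, symmetric]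
        by (subst nn_integral_multc) (simp_all add: ac_simps borel_measurable_indicator)
    qed
    also have "\<dots> = (\<integral>\<^sup>+ \<omega>. indicator (Obs j) (X (Suc t) \<omega>) *
          (emeasure (update \<rho> j (\<kappa> \<omega>) (U t \<omega>)) C * indicator D' \<omega>) \<partial>M)"
    proof (rule nn_integral_disintegrates[symmetric,
          OF subalgebra_history measurable_state disintegrates_prediction[OF dis]])
      note [measurable] = borel_measurable_emeasure_kernel[OF upd[OF j] C] D' Oj
      show "(\<lambda>(x, \<omega>). indicator (Obs j) x *
          (emeasure (update \<rho> j (\<kappa> \<omega>) (U t \<omega>)) C * indicator D' \<omega>)) \<in> borel_measurable (MX \<Otimes>\<^sub>M ?H)"
        by measurable
    qed
    also have "\<dots> = (\<integral>\<^sup>+ \<omega>\<in>D \<inter> Y (Suc t) -` {j}. emeasure (?new \<omega>) C \<partial>M)"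
      using observation_iff[OF _ j, of _ "Suc t"]
      by (intro nn_integral_cong, subst cell) (auto simp: indicator_def)
    finally show ?thesis .
  qed
  have gX: "indicator (X (Suc t) -` C \<inter> space M) \<in> borel_measurable M"
    using measurable_sets[OF measurable_state C] by (rule borel_measurable_indicator)
  have gnew: "(\<lambda>\<omega>. emeasure (?new \<omega>) C) \<in> borel_measurable M"
    using borel_measurable_emeasure_kernel[OF new C] by (rule measurable_from_subalg[OF subalgebra_history])
  have "X (Suc t) -` C \<inter> D = (X (Suc t) -` C \<inter> space M) \<inter> D"
    using sets.sets_into_space[OF DM] by auto
  then have "emeasure M (X (Suc t) -` C \<inter> D) = (\<integral>\<^sup>+ \<omega>\<in>D. indicator (X (Suc t) -` C \<inter> space M) \<omega> \<partial>M)"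
    using measurable_sets[OF measurable_state C, of "Suc t"] DM
    by (simp add: indicator_inter_arith[symmetric])
  also have "\<dots> = (\<integral>\<^sup>+ \<omega>\<in>D. emeasure (?new \<omega>) C \<partial>M)"
    unfolding nn_integral_split_observation[OF gX DM, of "Suc t"]
      nn_integral_split_observation[OF gnew DM, of "Suc t"]
    by (intro sum.cong refl branch)
  finally show "emeasure M (X (Suc t) -` C \<inter> D) = (\<integral>\<^sup>+ \<omega>\<in>D. emeasure (?new \<omega>) C \<partial>M)" .
qed

end

theorem theorem3:
  fixes M :: "'w measure"
    and MX :: "'x measure" and MU :: "'u measure" and ME :: "'e measure" and MV :: "'v measure"
    and \<rho> :: "nat \<Rightarrow> 'x measure"
    and \<pi> \<pi>_pred :: "nat \<Rightarrow> 'w \<Rightarrow> 'x measure"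
    and t :: nat
  assumes system:
      "partially_observed_system M MX MU ME MV G \<nu>\<eta> \<nu>\<epsilon> X U \<eta> \<epsilon> m r A J Obs Y"
    and filter_law:
      "\<And>s. regular_conditional_law M (history M MU Y U s) (X s) MX (\<pi> s)"
    and predictive_law:
      "\<And>s. regular_conditional_law M (history M MU Y U s) (X (Suc s)) MX (\<pi>_pred (Suc s))"
    and fallback:
      "\<And>j. j \<in> {1..r + 1} \<Longrightarrow> Obs j \<noteq> {} \<Longrightarrow>
         \<rho> j \<in> space (prob_algebra MX) \<and> emeasure (\<rho> j) (Obs j) = 1"
  shows
    "AE \<omega> in M.
       \<pi>_pred (Suc t) \<omega> = predict MX G \<nu>\<eta> \<nu>\<epsilon> (U t \<omega>) (\<pi> t \<omega>) \<and>
       (\<forall>j\<in>{1..r + 1}. Obs j \<noteq> {} \<longrightarrow>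
          (let p = obs_prob MX G \<nu>\<eta> \<nu>\<epsilon> Obs j (\<pi> t \<omega>) (U t \<omega>);
               \<pi>_tilde = restricted_predict MX G \<nu>\<eta> \<nu>\<epsilon> Obs (U t \<omega>) j (\<pi> t \<omega>);
               \<Phi> = filter_update MX G \<nu>\<eta> \<nu>\<epsilon> Obs \<rho> j (\<pi> t \<omega>) (U t \<omega>)
           in
             (\<forall>C\<in>sets MX. emeasure \<pi>_tilde C =
                (\<integral>\<^sup>+ x. (\<integral>\<^sup>+ e. (\<integral>\<^sup>+ v. indicator (C \<inter> Obs j) (G (x, U t \<omega>, e, v))
                   \<partial>\<nu>\<epsilon>) \<partial>\<nu>\<eta>) \<partial>(\<pi> t \<omega>))) \<and>
             emeasure \<pi>_tilde (space MX) = ennreal p \<and>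
             p = conditional_probability M (history M MU Y U t)
                   {\<omega>' \<in> space M. Y (Suc t) \<omega>' = j} \<omega> \<and>
             (Y (Suc t) \<omega> = j \<and> p > 0 \<longrightarrow>
                \<pi> (Suc t) \<omega> = \<Phi> \<and>
                \<Phi> = scale_measure (1 / emeasure \<pi>_tilde (space MX)) \<pi>_tilde))) \<and>
       \<pi> (Suc t) \<omega> =
         filter_update MX G \<nu>\<eta> \<nu>\<epsilon> Obs \<rho> (Y (Suc t) \<omega>) (\<pi> t \<omega>) (U t \<omega>)"
proof -
  interpret partially_observed_system M MX MU ME MV G \<nu>\<eta> \<nu>\<epsilon> X U \<eta> \<epsilon> m r A J Obs Y
    by (rule system)
  let ?H = "history M MU Y U t"
  have std: "standard_borel MX" by (rule standard_borel_spaces)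
  have dis: "disintegrates M ?H (X t) MX (\<pi> t)"
    using disintegrates_iff_regular_conditional_law[OF subalgebra_history measurable_state] filter_law
    by blast
  have pred_law: "regular_conditional_law M ?H (X (Suc t)) MX
      (\<lambda>\<omega>. predict MX G \<nu>\<eta> \<nu>\<epsilon> (U t \<omega>) (\<pi> t \<omega>))"
    using disintegrates_iff_regular_conditional_law[OF subalgebra_history measurable_state]
      disintegrates_prediction[OF dis] by blast
  have upd_law: "regular_conditional_law M (history M MU Y U (Suc t)) (X (Suc t)) MX
      (\<lambda>\<omega>. filter_update MX G \<nu>\<eta> \<nu>\<epsilon> Obs \<rho> (Y (Suc t) \<omega>) (\<pi> t \<omega>) (U t \<omega>))"
    using disintegrates_iff_regular_conditional_law[OF subalgebra_history measurable_state]
      disintegrates_update[OF dis, of \<rho>] fallback by (auto simp: possible_observations_def)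
  have i: "AE \<omega> in M. \<pi>_pred (Suc t) \<omega> = predict MX G \<nu>\<eta> \<nu>\<epsilon> (U t \<omega>) (\<pi> t \<omega>)"
    by (rule regular_conditional_law_AE_unique[OF std space_history predictive_law pred_law])
  have iv: "AE \<omega> in M. \<pi> (Suc t) \<omega>
      = filter_update MX G \<nu>\<eta> \<nu>\<epsilon> Obs \<rho> (Y (Suc t) \<omega>) (\<pi> t \<omega>) (U t \<omega>)"
    by (rule regular_conditional_law_AE_unique[OF std space_history filter_law upd_law])
  have "AE \<omega> in M. obs_prob MX G \<nu>\<eta> \<nu>\<epsilon> Obs j (\<pi> t \<omega>) (U t \<omega>)
      = conditional_probability M ?H {\<omega>' \<in> space M. Y (Suc t) \<omega>' = j} \<omega>"
    if j: "j \<in> {1..r + 1}" for j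
  proof -
    have "X (Suc t) -` Obs j \<inter> space M = {\<omega>' \<in> space M. Y (Suc t) \<omega>' = j}"
      using observation[OF _ j] by auto
    then show ?thesis
      using pred_law measurable_Obs[OF j] unfolding regular_conditional_law_def obs_prob_def by metis
  qed
  then have iii: "AE \<omega> in M. \<forall>j\<in>{1..r + 1}. obs_prob MX G \<nu>\<eta> \<nu>\<epsilon> Obs j (\<pi> t \<omega>) (U t \<omega>)
      = conditional_probability M ?H {\<omega>' \<in> space M. Y (Suc t) \<omega>' = j} \<omega>"
    by (intro AE_finite_allI) auto
  from i iii iv AE_space[of M] show ?thesis
  proof eventually_elim
    case (elim \<omega>)
    have \<pi>: "\<pi> t \<omega> \<in> space (prob_algebra MX)"
      using measurable_space[OF disintegratesD(1)[OF dis]] elim(4) by simp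
    have u: "U t \<omega> \<in> space MU" using measurable_space[OF admissible[of t]] elim(4) by simp
    have restricted: "emeasure (restricted_predict MX G \<nu>\<eta> \<nu>\<epsilon> Obs (U t \<omega>) j (\<pi> t \<omega>)) C
        = emeasure (prediction (U t \<omega>) (\<pi> t \<omega>)) (C \<inter> Obs j)"
      if "j \<in> {1..r + 1}" "C \<in> sets MX" for j C
      by (rule emeasure_restricted_predict[of Obs j MX, OF measurable_Obs[OF that(1)] that(2)])
    have ii: "emeasure (restricted_predict MX G \<nu>\<eta> \<nu>\<epsilon> Obs (U t \<omega>) j (\<pi> t \<omega>)) C =
        (\<integral>\<^sup>+ x. (\<integral>\<^sup>+ e. (\<integral>\<^sup>+ v. indicator (C \<inter> Obs j) (G (x, U t \<omega>, e, v))
           \<partial>\<nu>\<epsilon>) \<partial>\<nu>\<eta>) \<partial>(\<pi> t \<omega>))"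
      if "j \<in> {1..r + 1}" "C \<in> sets MX" for j C
      using measurable_Obs[OF that(1)] that(2)
      by (simp add: restricted[OF that] emeasure_prediction[OF \<pi> u] controlled_kernel_def)
    have mass: "emeasure (restricted_predict MX G \<nu>\<eta> \<nu>\<epsilon> Obs (U t \<omega>) j (\<pi> t \<omega>)) (space MX)
        = ennreal (obs_prob MX G \<nu>\<eta> \<nu>\<epsilon> Obs j (\<pi> t \<omega>) (U t \<omega>))"
      if j: "j \<in> {1..r + 1}" for j
      using sets.sets_into_space[OF measurable_Obs[OF j]]
      by (simp add: restricted[OF j sets.top] obs_prob_eq_emeasure[OF \<pi> u] Int_absorb1)
    have quotient: "filter_update MX G \<nu>\<eta> \<nu>\<epsilon> Obs \<rho> j (\<pi> t \<omega>) (U t \<omega>)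
        = scale_measure (1 / emeasure (restricted_predict MX G \<nu>\<eta> \<nu>\<epsilon> Obs (U t \<omega>) j (\<pi> t \<omega>)) (space MX))
            (restricted_predict MX G \<nu>\<eta> \<nu>\<epsilon> Obs (U t \<omega>) j (\<pi> t \<omega>))"
      if "j \<in> {1..r + 1}" "obs_prob MX G \<nu>\<eta> \<nu>\<epsilon> Obs j (\<pi> t \<omega>) (U t \<omega>) > 0" for j
      using that(2) by (simp add: mass[OF that(1)] filter_update_def)
    show ?case
      unfolding Let_def
    proof (intro conjI ballI impI)
      show "\<pi>_pred (Suc t) \<omega> = predict MX G \<nu>\<eta> \<nu>\<epsilon> (U t \<omega>) (\<pi> t \<omega>)" by (rule elim(1))
      show "\<pi> (Suc t) \<omega> = filter_update MX G \<nu>\<eta> \<nu>\<epsilon> Obs \<rho> (Y (Suc t) \<omega>) (\<pi> t \<omega>) (U t \<omega>)"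
        by (rule elim(3))
    next
      fix j assume "j \<in> {1..r + 1}" "Y (Suc t) \<omega> = j \<and> obs_prob MX G \<nu>\<eta> \<nu>\<epsilon> Obs j (\<pi> t \<omega>) (U t \<omega>) > 0"
      then show "\<pi> (Suc t) \<omega> = filter_update MX G \<nu>\<eta> \<nu>\<epsilon> Obs \<rho> j (\<pi> t \<omega>) (U t \<omega>)"
        using elim(3) by simp
    qed (use ii mass quotient elim(2) in blast)+
  qed
qed

end
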